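(* For every dimension $n$ and every $\alpha>0$ there exists a constant $C_0=C_0(\alpha,n)$ such that the following holds. Let $\Omega\subset\mathbb{R}^n$ be a bounded $\alpha$-asymmetric domain, let $D\subset\mathbb{R}^n$ be a bounded convex domain, and let $\bar x\in\mathbb{R}^n$ be such that the translate $\bar x+D$ maximizes $\lambda_1(\Omega\setminus(x+D))$ among all $x\in\mathbb{R}^n$. If $\lambda_1(\Omega\setminus(\bar x+D))\ge C\lambda_1(\Omega)$ for some $C\ge C_0$, then $\rho_{\bar x}=0$. In other words, either $\mu_\Omega$ is comparable to $\lambda_1(\Omega)$, in the sense that $\lambda_1(\Omega)\le\mu_\Omega< C_0\lambda_1(\Omega)$, or $\rho_{\bar x}=0$.
   Context: A domain is a nonempty connected open set. For $\alpha>0$, a bounded domain $\Omega\subset\mathbb{R}^n$ is called $\alpha$-asymmetric if for all $y\in\partial\Omega$ and all $r>0$, $\frac{|B_r(y)\setminus\Omega|}{|B_r(y)|}\ge\alpha$, where $B_r(y)$ is the ball of radius $r$ centered at $y$ and $|\cdot|$ is Lebesgue measure. $\lambda_1(U)$ denotes the first eigenvalue of $-\Delta$ on $U$ with Dirichlet boundary conditions; for the set $U=\Omega\setminus(x+D)$ this is understood as the infimum of $\int|\nabla u|^2/\int u^2$ over nonzero $u\in C_c^\infty(\operatorname{int}U)$ ($+\infty$ if the interior is empty). $\phi_{\lambda_1(\Omega)}>0$ denotes the first Dirichlet eigenfunction (ground state) of $\Omega$, and $$M:=\{y\in\Omega:\ \phi_{\lambda_1(\Omega)}(y)=\|\phi_{\lambda_1(\Omega)}\|_{L^\infty(\Omega)}\}$$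 is its set of maximum points. For $x\in\mathbb{R}^n$, $x+D$ is the translate of $D$ by $x$, and $$\rho_x:=\max_{y\in M} d(y,x+D),\qquad \mu_\Omega:=\max_{x\in\mathbb{R}^n}\lambda_1(\Omega\setminus(x+D)),$$ where $d(y,x+D)$ is the Euclidean distance from the point $y$ to the set $x+D$. *)

theory Defs
  imports "HOL-Analysis.Analysis" "HOL-Probability.Essential_Supremum"
begin

definition domain :: "(real^'n) set \<Rightarrow> bool" where
  "domain S \<longleftrightarrow> S \<noteq> {} \<and> connected S \<and> open S"

definition asymmetric :: "real \<Rightarrow> (real^'n) set \<Rightarrow> bool" where
  "asymmetric \<alpha> \<Omega> \<longleftrightarrow>
     (\<forall>y\<in>frontier \<Omega>. \<forall>r>0.
        measure lebesgue (ball y r - \<Omega>) / measure lebesgue (ball y r) \<ge> \<alpha>)"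

definition translate :: "real^'n \<Rightarrow> (real^'n) set \<Rightarrow> (real^'n) set" where
  "translate x D = (\<lambda>z. x + z) ` D"

definition pderiv_at :: "'n \<Rightarrow> (real^'n \<Rightarrow> real) \<Rightarrow> real^'n \<Rightarrow> real" where
  "pderiv_at i f x = frechet_derivative f (at x) (axis i 1)"

definition grad :: "(real^'n \<Rightarrow> real) \<Rightarrow> real^'n \<Rightarrow> real^'n" where
  "grad f x = (\<chi> i. pderiv_at i f x)"

definition laplacian :: "(real^'n \<Rightarrow> real) \<Rightarrow> real^'n \<Rightarrow> real" where
  "laplacian f x = (\<Sum>i\<in>UNIV. pderiv_at i (pderiv_at i f) x)"

(* Only meant for open S: the derivatives are two-sided ones at points of S. *)
primrec C_k_on :: "nat \<Rightarrow> (real^'n) set \<Rightarrow> (real^'n \<Rightarrow> real) \<Rightarrow> bool" where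
  "C_k_on 0 S f \<longleftrightarrow> continuous_on S f"
| "C_k_on (Suc k) S f \<longleftrightarrow>
     (\<forall>x\<in>S. f differentiable (at x)) \<and> (\<forall>i. C_k_on k S (pderiv_at i f))"

definition smooth_on :: "(real^'n) set \<Rightarrow> (real^'n \<Rightarrow> real) \<Rightarrow> bool" where
  "smooth_on S f \<longleftrightarrow> (\<forall>k. C_k_on k S f)"

(* The space of smooth functions with compact support in the open set U,
   extended by zero to the whole space. *)
definition test_fun :: "(real^'n) set \<Rightarrow> (real^'n \<Rightarrow> real) \<Rightarrow> bool" where
  "test_fun U u \<longleftrightarrow> smooth_on UNIV u \<and>
     compact (closure {x. u x \<noteq> 0}) \<and> closure {x. u x \<noteq> 0} \<subseteq> U"

definition rayleigh :: "(real^'n \<Rightarrow> real) \<Rightarrow> real" where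
  "rayleigh u = (LINT x|lebesgue. (norm (grad u x))\<^sup>2) / (LINT x|lebesgue. (u x)\<^sup>2)"

(* The infimum is taken in the extended reals, so it is infinity
   when interior U is empty. *)
definition lambda1 :: "(real^'n) set \<Rightarrow> ereal" where
  "lambda1 U = (INF u\<in>{u. test_fun (interior U) u \<and> (\<exists>x. u x \<noteq> 0)}. ereal (rayleigh u))"

(* Membership in the closure of the test functions in the Sobolev norm, for f differentiable
   on the open set \<Omega> (so that the classical gradient is the weak one).  The nonnegative
   integral is used because, unlike the Bochner integral, it is infinite rather than 0
   when the integrand is not integrable. *)
definition in_H10 :: "(real^'n) set \<Rightarrow> (real^'n \<Rightarrow> real) \<Rightarrow> bool" where
  "in_H10 \<Omega> f \<longleftrightarrow> (\<exists>u. (\<forall>k::nat. test_fun \<Omega> (u k)) \<and>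
     (\<lambda>k. \<integral>\<^sup>+x\<in>\<Omega>. ennreal ((f x - u k x)\<^sup>2 + (norm (grad f x - grad (u k) x))\<^sup>2) \<partial>lebesgue)
       \<longlonglongrightarrow> 0)"

(* A first Dirichlet eigenfunction, normalised only by its sign.  Interior regularity
   makes it smooth in \<Omega>, so the equation is stated pointwise; the boundary condition is
   membership in the Sobolev space.  Values of \<phi> outside \<Omega> are irrelevant. *)
definition ground_state :: "(real^'n) set \<Rightarrow> (real^'n \<Rightarrow> real) \<Rightarrow> bool" where
  "ground_state \<Omega> \<phi> \<longleftrightarrow> smooth_on \<Omega> \<phi> \<and> in_H10 \<Omega> \<phi> \<and> (\<forall>x\<in>\<Omega>. \<phi> x > 0) \<and>
     (\<forall>x\<in>\<Omega>. ereal (- laplacian \<phi> x) = lambda1 \<Omega> * ereal (\<phi> x))"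

definition Linf_norm :: "(real^'n) set \<Rightarrow> (real^'n \<Rightarrow> real) \<Rightarrow> ereal" where
  "Linf_norm \<Omega> f = esssup (lebesgue_on \<Omega>) (\<lambda>x. ereal \<bar>f x\<bar>)"

definition max_points :: "(real^'n) set \<Rightarrow> (real^'n \<Rightarrow> real) \<Rightarrow> (real^'n) set" where
  "max_points \<Omega> \<phi> = {y\<in>\<Omega>. ereal (\<phi> y) = Linf_norm \<Omega> \<phi>}"

(* The set over which the supremum is taken is M when \<phi> is a ground state of \<Omega>; it does
   not depend on the choice of \<phi>, which is unique up to a positive factor. *)
definition rho :: "(real^'n) set \<Rightarrow> (real^'n \<Rightarrow> real) \<Rightarrow> (real^'n) set \<Rightarrow> real^'n \<Rightarrow> real" where
  "rho \<Omega> \<phi> D x = (SUP y\<in>max_points \<Omega> \<phi>. infdist y (translate x D))"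

definition mu :: "(real^'n) set \<Rightarrow> (real^'n) set \<Rightarrow> ereal" where
  "mu \<Omega> D = (SUP x. lambda1 (\<Omega> - translate x D))"

definition maximizing_translate :: "(real^'n) set \<Rightarrow> (real^'n) set \<Rightarrow> real^'n \<Rightarrow> bool" where
  "maximizing_translate \<Omega> D xb \<longleftrightarrow>
     (\<forall>x. lambda1 (\<Omega> - translate x D) \<le> lambda1 (\<Omega> - translate xb D))"

end

(* Extended by zero, the ground state phi satisfies -Laplace phi <= lambda phi weakly on the whole
   space.  Hence e^(lambda t) times its heat flow at time t is nondecreasing in t, which gives
     phi(x) <= e^(lambda t) * (heat kernel average of phi at time t around x)   for all t > 0.
   With t = 1 this bounds phi; t -> infinity excludes lambda = 0; and with t = r^2 at a point
   closer than r to the boundary, the mass that the heat kernel puts on the complement of Omega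
   (at least a multiple of alpha) forces phi <= theta * sup phi with theta < 1, provided
   lambda r^2 is a small constant depending on alpha and n only.  So the maximum is attained, and
   B_r(y) lies in Omega for every maximum point y.  If y is not in the closure of the convex
   obstacle, a half of B_r(y) avoids the obstacle, and a bump function supported there shows that
   lambda_1 of the complement is at most a constant times r^(-2), that is, times lambda. *)
theory Submission
  imports Defs "HOL-Probability.Distributions"
begin

text \<open>The boundary may be arbitrarily rough, and \<phi> vanishes there only in the sense of
  being a Sobolev limit of test functions. Every integration by parts is therefore done for
  functions of compact support and then passed to the limit. The heat kernel suits this: it is
  positive and smooth on the whole space, and as \<Omega> is bounded it needs no cut-off. Its
  Laplacian is its time derivative, so the weak inequality becomes a differential inequality in t
  alone. By scaling, the constants at time r^2 are free of r. Let G be the mass of the kernel and c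
  = \<alpha> |B_1| / (e G), the fraction of the mass that the complement is sure to receive around a
  point closer than r to the boundary. There the average of \<phi> is at most (1 - c) G sup \<phi>.
  The choice lambda r^2 = ln (1 + c) gives theta = (1 + c)(1 - c) = 1 - c^2 < 1. Beside the obstacle
  there is room for a closed ball of radius r / 4, whose bump has Rayleigh quotient 16 K / r^2 with
  K depending on n only. Since 1 / r^2 = lambda / ln (1 + c), this is a fixed multiple of
  lambda.\<close>

section \<open>Differentiation and integration by parts\<close>

text \<open>The mean value theorem turns the bound on f' into the bound w for all difference
  quotients, which is what dominated convergence needs. The parameter s is a spatial shift in the
  integration by parts and the time in the heat flow.\<close>

lemma integral_has_real_derivative_dominated:
  fixes f f' :: "real \<Rightarrow> 'a \<Rightarrow> real"
  assumes w: "integrable M w"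
    and int: "\<And>s. a < s \<Longrightarrow> s < b \<Longrightarrow> integrable M (f s)"
    and der: "\<And>s x. a < s \<Longrightarrow> s < b \<Longrightarrow> ((\<lambda>s. f s x) has_real_derivative f' s x) (at s)"
    and bd: "\<And>s x. a < s \<Longrightarrow> s < b \<Longrightarrow> \<bar>f' s x\<bar> \<le> w x"
    and meas: "f' t \<in> borel_measurable M"
    and t: "a < t" "t < b"
  shows "((\<lambda>s. LINT x|M. f s x) has_real_derivative (LINT x|M. f' t x)) (at t)"
  unfolding has_field_derivative_iff tendsto_at_iff_sequentially comp_def
proof (intro allI impI)
  fix X :: "nat \<Rightarrow> real"
  assume X: "\<forall>i. X i \<in> UNIV - {t}" and Xt: "X \<longlonglongrightarrow> t"
  have "eventually (\<lambda>n. X n \<in> {a<..<b}) sequentially"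
    using Xt t by (intro topological_tendstoD) auto
  then obtain N where N: "\<And>n. n \<ge> N \<Longrightarrow> X n \<in> {a<..<b}"
    by (auto simp: eventually_sequentially)
  \<comment> \<open>The first N terms of X are cut off so that every \<open>Y n\<close> lies in the
    interval where \<open>der\<close> and \<open>bd\<close> hold; \<open>LIMSEQ_offset\<close> puts
    them back at the end.\<close>
  define Y where "Y n = X (n + N)" for n
  have Y: "Y n \<noteq> t" "a < Y n" "Y n < b" for n
    using X N[of "n+N"] by (auto simp: Y_def)
  have Yt: "Y \<longlonglongrightarrow> t"
    unfolding Y_def using Xt by (rule LIMSEQ_ignore_initial_segment)
  have "(\<lambda>n. LINT x|M. (f (Y n) x - f t x) / (Y n - t)) \<longlonglongrightarrow> (LINT x|M. f' t x)"
  proof (rule integral_dominated_convergence[OF meas _ w])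
    show "(\<lambda>x. (f (Y n) x - f t x) / (Y n - t)) \<in> borel_measurable M" for n
      using int[OF Y(2,3)[of n]] int[OF t] by measurable
    show "AE x in M. (\<lambda>n. (f (Y n) x - f t x) / (Y n - t)) \<longlonglongrightarrow> f' t x"
    proof (rule AE_I2)
      fix x
      have "((\<lambda>s. (f s x - f t x) / (s - t)) \<longlongrightarrow> f' t x) (at t)"
        using der[OF t, of x] by (simp add: has_field_derivative_iff)
      then show "(\<lambda>n. (f (Y n) x - f t x) / (Y n - t)) \<longlonglongrightarrow> f' t x"
        unfolding tendsto_at_iff_sequentially comp_def using Y(1) Yt by auto
    qed
    show "AE x in M. norm ((f (Y n) x - f t x) / (Y n - t)) \<le> w x" for n
    proof (rule AE_I2)
      fix x
      have "\<bar>f (Y n) x - f t x\<bar> \<le> w x * \<bar>Y n - t\<bar>"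
      proof (unfold real_norm_def[symmetric],
          rule field_differentiable_bound[of "{a<..<b}" "\<lambda>s. f s x" "\<lambda>s. f' s x"])
        show "((\<lambda>s. f s x) has_field_derivative f' s x) (at s within {a<..<b})" if "s \<in> {a<..<b}" for s
          by (rule has_field_derivative_at_within, rule der) (use that in auto)
        show "norm (f' s x) \<le> w x" if "s \<in> {a<..<b}" for s
          using bd[of s x] that by simp
      qed (use Y[of n] t in auto)
      then show "norm ((f (Y n) x - f t x) / (Y n - t)) \<le> w x"
        using Y(1)[of n] by (simp add: pos_divide_le_eq)
    qed
  qed
  moreover have "(LINT x|M. (f (Y n) x - f t x) / (Y n - t))
      = ((LINT x|M. f (Y n) x) - (LINT x|M. f t x)) / (Y n - t)" for n
    using int[OF Y(2,3)[of n]] int[OF t] by simp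
  ultimately have "(\<lambda>n. ((LINT x|M. f (X (n+N)) x) - (LINT x|M. f t x)) / (X (n+N) - t))
      \<longlonglongrightarrow> (LINT x|M. f' t x)"
    by (simp only: Y_def)
  then show "(\<lambda>n. ((LINT x|M. f (X n) x) - (LINT x|M. f t x)) / (X n - t)) \<longlonglongrightarrow> (LINT x|M. f' t x)"
    by (rule LIMSEQ_offset)
qed

section \<open>Partial derivatives and continuously differentiable functions\<close>

lemma has_derivative_pderiv_at:
  fixes f :: "real^'n \<Rightarrow> real"
  assumes "f differentiable (at x)"
  shows "(f has_derivative (\<lambda>v. \<Sum>i\<in>UNIV. v $ i * pderiv_at i f x)) (at x)"
proof -
  let ?D = "frechet_derivative f (at x)"
  have D: "(f has_derivative ?D) (at x)"
    using assms by (simp add: frechet_derivative_works)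
  then interpret bounded_linear ?D by (rule has_derivative_bounded_linear)
  have "?D v = (\<Sum>i\<in>UNIV. v $ i * pderiv_at i f x)" for v
  proof -
    have "?D v = ?D (\<Sum>i\<in>UNIV. v $ i *\<^sub>R axis i 1)"
      by (simp add: basis_expansion flip: scalar_mult_eq_scaleR)
    also have "\<dots> = (\<Sum>i\<in>UNIV. v $ i * pderiv_at i f x)"
      by (simp add: sum scaleR pderiv_at_def)
    finally show ?thesis .
  qed
  then have "?D = (\<lambda>v. \<Sum>i\<in>UNIV. v $ i * pderiv_at i f x)" by auto
  with D show ?thesis by simp
qed

lemma pderiv_at_eqI:
  assumes "(f has_derivative D) (at x)"
  shows "pderiv_at i f x = D (axis i 1)"
  using frechet_derivative_at[OF assms] by (simp add: pderiv_at_def)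

lemma pderiv_at_eqI':
  fixes f :: "real^'n \<Rightarrow> real"
  assumes "(f has_derivative (\<lambda>v. \<Sum>i\<in>UNIV. v $ i * g i)) (at x)"
  shows "pderiv_at i f x = g i"
  by (simp add: pderiv_at_eqI[OF assms] axis_def if_distrib if_distribR cong: if_cong)

lemma smooth_onD:
  assumes "smooth_on S f"
  shows "continuous_on S f" "x \<in> S \<Longrightarrow> f differentiable (at x)" "smooth_on S (pderiv_at i f)"
proof -
  have C: "C_k_on k S f" for k using assms by (simp add: smooth_on_def)
  show "continuous_on S f" using C[of 0] by simp
  show "x \<in> S \<Longrightarrow> f differentiable (at x)" using C[of "Suc 0"] by simp
  show "smooth_on S (pderiv_at i f)"
    unfolding smooth_on_def
  proof
    fix k show "C_k_on k S (pderiv_at i f)" using C[of "Suc k"] by simp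
  qed
qed

text \<open>The partial derivatives are a parameter instead of \<open>pderiv_at\<close>, so that the
  product and chain rules produce them as explicit terms, which can be differentiated again.\<close>

definition C1_with :: "(real^'n \<Rightarrow> real) \<Rightarrow> ('n \<Rightarrow> real^'n \<Rightarrow> real) \<Rightarrow> bool" where
  "C1_with f f' \<longleftrightarrow>
     (\<forall>x. (f has_derivative (\<lambda>v. \<Sum>i\<in>UNIV. v $ i * f' i x)) (at x)) \<and> (\<forall>i. continuous_on UNIV (f' i))"

lemma C1_withD:
  assumes "C1_with f f'"
  shows "(f has_derivative (\<lambda>v. \<Sum>i\<in>UNIV. v $ i * f' i x)) (at x)"
    "continuous_on UNIV (f' i)" "continuous_on UNIV f"
proof -
  show d: "(f has_derivative (\<lambda>v. \<Sum>i\<in>UNIV. v $ i * f' i x)) (at x)" for x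
    using assms by (simp add: C1_with_def)
  show "continuous_on UNIV (f' i)" using assms by (simp add: C1_with_def)
  show "continuous_on UNIV f"
    using has_derivative_continuous[OF d] by (simp add: continuous_on_eq_continuous_at)
qed

lemma C1_with_smooth_on:
  assumes "smooth_on UNIV u"
  shows "C1_with u (\<lambda>i. pderiv_at i u)"
  unfolding C1_with_def
  using smooth_onD[OF assms] smooth_onD(1)[OF smooth_onD(3)[OF assms]]
  by (auto intro!: has_derivative_pderiv_at)

lemma C1_with_mult:
  assumes "C1_with f f'" "C1_with g g'"
  shows "C1_with (\<lambda>x. f x * g x) (\<lambda>i x. f x * g' i x + f' i x * g x)"
  unfolding C1_with_def
proof (intro conjI allI)
  fix x
  show "((\<lambda>x. f x * g x) has_derivative
      (\<lambda>v. \<Sum>i\<in>UNIV. v $ i * (f x * g' i x + f' i x * g x))) (at x)"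
    by (rule has_derivative_eq_rhs[OF has_derivative_mult[OF C1_withD(1)[OF assms(1)] C1_withD(1)[OF assms(2)]]])
       (simp add: fun_eq_iff sum_distrib_left sum_distrib_right sum.distrib algebra_simps)
next
  show "continuous_on UNIV (\<lambda>x. f x * g' i x + f' i x * g x)" for i
    using C1_withD[OF assms(1)] C1_withD[OF assms(2)] by (intro continuous_intros)
qed

lemma C1_with_compose:
  assumes f: "C1_with f f'" and h: "\<And>s. (h has_real_derivative h' s) (at s)" "continuous_on UNIV h'"
  shows "C1_with (\<lambda>x. h (f x)) (\<lambda>i x. h' (f x) * f' i x)"
  unfolding C1_with_def
proof (intro conjI allI)
  fix x
  show "((\<lambda>x. h (f x)) has_derivative (\<lambda>v. \<Sum>i\<in>UNIV. v $ i * (h' (f x) * f' i x))) (at x)"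
    by (rule has_derivative_eq_rhs[OF DERIV_compose_FDERIV[OF h(1) C1_withD(1)[OF f]]])
      (simp add: sum_distrib_left sum_distrib_right algebra_simps)
next
  show "continuous_on UNIV (\<lambda>x. h' (f x) * f' i x)" for i
    using C1_withD[OF f] h(2)
    by (intro continuous_intros continuous_on_compose2[OF h(2)]) auto
qed

section \<open>Integration by parts for compactly supported functions\<close>

lemma lborel_integral_translate:
  fixes f :: "'a::euclidean_space \<Rightarrow> real"
  assumes [measurable]: "f \<in> borel_measurable borel"
  shows "(LINT x|lborel. f (c + x)) = (LINT x|lborel. f x)"
    "integrable lborel (\<lambda>x. f (c + x)) \<longleftrightarrow> integrable lborel f"
proof -
  have 1: "lborel = distr lborel borel ((+) c)" by (simp add: lborel_distr_plus)
  show "(LINT x|lborel. f (c + x)) = (LINT x|lborel. f x)"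
    by (subst (2) 1, subst integral_distr) auto
  show "integrable lborel (\<lambda>x. f (c + x)) \<longleftrightarrow> integrable lborel f"
    by (subst (2) 1, subst integrable_distr_eq) auto
qed

text \<open>Translation invariance replaces Fubini: the integral of F shifted by s along the i-th
  axis does not depend on s, and its derivative at s = 0 is the integral of
  \<open>F' i\<close>.\<close>

lemma integral_partial_derivative_eq_0:
  fixes F :: "real^'n \<Rightarrow> real"
  assumes F: "C1_with F F'" and K: "compact K" "\<And>x. x \<notin> K \<Longrightarrow> F x = 0" "\<And>x. x \<notin> K \<Longrightarrow> F' i x = 0"
  shows "integrable lborel (F' i)" "(LINT x|lborel. F' i x) = 0"
proof -
  have Fm [measurable]: "F \<in> borel_measurable borel" "F' i \<in> borel_measurable borel"
    using C1_withD[OF F] borel_measurable_continuous_onI by blast+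
  have bdd: "bounded (F' i ` K)" "bounded (F ` K)"
    using continuous_on_subset[OF C1_withD(2)[OF F, of i] subset_UNIV[of K]]
      continuous_on_subset[OF C1_withD(3)[OF F] subset_UNIV[of K]] K(1)
    by (auto intro!: compact_imp_bounded compact_continuous_image)
  obtain B where B: "\<And>x. x \<in> K \<Longrightarrow> \<bar>F' i x\<bar> \<le> B"
    using bdd(1) unfolding bounded_iff by auto
  obtain B0 where B0: "\<And>x. x \<in> K \<Longrightarrow> \<bar>F x\<bar> \<le> B0"
    using bdd(2) unfolding bounded_iff by auto
  obtain R where R: "\<And>x. x \<in> K \<Longrightarrow> norm x \<le> R"
    using compact_imp_bounded[OF K(1)] by (auto simp: bounded_iff)
  have Bnn: "\<bar>F' i x\<bar> \<le> \<bar>B\<bar>" for x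
    using B[of x] K(3)[of x] by (cases "x \<in> K") auto
  have B0nn: "\<bar>F x\<bar> \<le> \<bar>B0\<bar>" for x
    using B0[of x] K(2)[of x] by (cases "x \<in> K") auto
  \<comment> \<open>Only shifts with |s| < 1 are considered, so the radius R + 1 covers all shifted
    supports.\<close>
  have cb: "integrable lborel (\<lambda>x::real^'n. indicator (cball 0 (R+1)) x * c)" for c :: real
    using emeasure_bounded_finite[of "cball (0::real^'n) (R+1)"] by simp
  have intF: "integrable lborel F"
  proof (rule Bochner_Integration.integrable_bound[OF cb])
    show "AE x in lborel. norm (F x) \<le> norm (indicator (cball 0 (R+1)) x * \<bar>B0\<bar>)"
    proof (rule AE_I2)
      fix x show "norm (F x) \<le> norm (indicator (cball 0 (R+1)) x * \<bar>B0\<bar>)"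
        using B0nn[of x] R[of x] K(2)[of x] by (cases "x \<in> K") auto
    qed
  qed simp
  show "integrable lborel (F' i)"
  proof (rule Bochner_Integration.integrable_bound[OF cb])
    show "AE x in lborel. norm (F' i x) \<le> norm (indicator (cball 0 (R+1)) x * \<bar>B\<bar>)"
    proof (rule AE_I2)
      fix x show "norm (F' i x) \<le> norm (indicator (cball 0 (R+1)) x * \<bar>B\<bar>)"
        using Bnn[of x] R[of x] K(3)[of x] by (cases "x \<in> K") auto
    qed
  qed simp
  have "((\<lambda>s. LINT x|lborel. F (s *\<^sub>R axis i 1 + x)) has_real_derivative
      (LINT x|lborel. F' i (0 *\<^sub>R axis i 1 + x))) (at 0)"
  proof (rule integral_has_real_derivative_dominated[where a="-1" and b=1
        and w="\<lambda>x. indicator (cball 0 (R+1)) x * \<bar>B\<bar>" and f'="\<lambda>s x. F' i (s *\<^sub>R axis i 1 + x)"])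
    show "integrable lborel (\<lambda>x. F (s *\<^sub>R axis i 1 + x))" for s
      using intF by (simp add: lborel_integral_translate(2))
    fix s :: real and x :: "real^'n"
    have d: "((\<lambda>s. F (s *\<^sub>R axis i 1 + x)) has_derivative
        (\<lambda>h. \<Sum>j\<in>UNIV. (h *\<^sub>R axis i (1::real)) $ j * F' j (s *\<^sub>R axis i 1 + x))) (at s)"
      by (rule has_derivative_compose[OF _ C1_withD(1)[OF F]]) (auto intro!: derivative_eq_intros)
    have e: "(\<Sum>j\<in>UNIV. (h *\<^sub>R axis i (1::real)) $ j * G j) = h * G i" for h and G :: "'n \<Rightarrow> real"
      by (simp add: axis_def if_distrib if_distribR cong: if_cong)
    show "((\<lambda>s. F (s *\<^sub>R axis i 1 + x)) has_real_derivative F' i (s *\<^sub>R axis i 1 + x)) (at s)"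
      using d unfolding e has_field_derivative_def by (simp only: mult.commute[of _ "F' i (s *\<^sub>R axis i 1 + x)"])
    assume "-1 < s" "s < 1"
    have "norm x \<le> R + 1" if "s *\<^sub>R axis i 1 + x \<in> K"
    proof -
      have "norm x \<le> norm (s *\<^sub>R axis i 1 + x) + norm (s *\<^sub>R axis i (1::real) :: real^'n)"
        by (metis add_diff_cancel_left' norm_triangle_ineq4)
      then show ?thesis using R[OF that] \<open>-1 < s\<close> \<open>s < 1\<close> by simp
    qed
    then show "\<bar>F' i (s *\<^sub>R axis i 1 + x)\<bar> \<le> indicator (cball 0 (R+1)) x * \<bar>B\<bar>"
      using Bnn[of "s *\<^sub>R axis i 1 + x"] K(3)[of "s *\<^sub>R axis i 1 + x"] by (auto split: split_indicator)
  qed (use cb in auto)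
  then have "((\<lambda>s::real. LINT x|lborel. F x) has_real_derivative (LINT x|lborel. F' i x)) (at 0)"
    by (simp add: lborel_integral_translate(1))
  then show "(LINT x|lborel. F' i x) = 0"
    using DERIV_unique DERIV_const by blast
qed

lemma integrable_compact_support:
  fixes g :: "'a::euclidean_space \<Rightarrow> real"
  assumes "continuous_on UNIV g" "compact K" "\<And>x. x \<notin> K \<Longrightarrow> g x = 0"
  shows "integrable lborel g"
proof -
  have "integrable lborel (\<lambda>x. indicator K x *\<^sub>R g x)"
    by (rule borel_integrable_compact[OF assms(2) continuous_on_subset[OF assms(1) subset_UNIV]])
  moreover have "(\<lambda>x. indicator K x *\<^sub>R g x) = g"
    using assms(3) by (auto simp: fun_eq_iff split: split_indicator)
  ultimately show ?thesis by simp
qed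

section \<open>Products with functions supported inside the domain\<close>

lemma C1_with_eq_0_outside:
  assumes "C1_with v v'" "closed K" "\<And>x. x \<notin> K \<Longrightarrow> v x = 0" "x \<notin> K"
  shows "v' i x = 0"
proof -
  have "((\<lambda>_. 0) has_derivative (\<lambda>v. \<Sum>i\<in>UNIV. v $ i * v' i x)) (at x)"
    by (rule has_derivative_transform_within_open[OF C1_withD(1)[OF assms(1)], of "-K"])
      (use assms in auto)
  then have "(\<lambda>v. \<Sum>i\<in>UNIV. v $ i * v' i x) = (\<lambda>_. 0)"
    by (rule has_derivative_unique) auto
  from fun_cong[OF this, of "axis i 1"] show ?thesis
    by (simp add: axis_def if_distrib if_distribR cong: if_cong)
qed

text \<open>\<Omega> and the complement of K are open and cover the space, and on the second set the
  product is zero. Hence g may behave arbitrarily at the boundary of \<Omega>.\<close>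

lemma continuous_on_zero_extension:
  fixes g v :: "'a::euclidean_space \<Rightarrow> real"
  assumes "open \<Omega>" "closed K" "K \<subseteq> \<Omega>" "continuous_on \<Omega> g" "continuous_on UNIV v"
    and "\<And>x. x \<notin> K \<Longrightarrow> v x = 0"
  shows "continuous_on UNIV (\<lambda>x. indicator \<Omega> x * g x * v x)"
proof -
  have "continuous_on \<Omega> (\<lambda>x. indicator \<Omega> x * g x * v x)"
    by (rule continuous_on_eq[where f="\<lambda>x. g x * v x"])
      (use assms(4) continuous_on_subset[OF assms(5) subset_UNIV] in \<open>auto intro!: continuous_intros\<close>)
  moreover have "continuous_on (-K) (\<lambda>x. indicator \<Omega> x * g x * v x)"
    by (rule continuous_on_eq[where f="\<lambda>x. 0"]) (use assms in auto)
  ultimately have "continuous_on (\<Omega> \<union> -K) (\<lambda>x. indicator \<Omega> x * g x * v x)"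
    using assms by (intro continuous_on_open_Un) auto
  moreover have "\<Omega> \<union> -K = UNIV" using assms by auto
  ultimately show ?thesis by simp
qed

lemma C1_with_zero_extension:
  fixes g :: "real^'n \<Rightarrow> real"
  assumes \<Omega>: "open \<Omega>" and K: "closed K" "K \<subseteq> \<Omega>"
    and g: "smooth_on \<Omega> g"
    and v: "C1_with v v'" "\<And>x. x \<notin> K \<Longrightarrow> v x = 0"
  shows "C1_with (\<lambda>x. indicator \<Omega> x * g x * v x)
    (\<lambda>i x. indicator \<Omega> x * g x * v' i x + indicator \<Omega> x * pderiv_at i g x * v x)"
  unfolding C1_with_def
proof (intro conjI allI)
  note v0 = C1_with_eq_0_outside[OF v(1) K(1) v(2)]
  show "continuous_on UNIV (\<lambda>x. indicator \<Omega> x * g x * v' i x + indicator \<Omega> x * pderiv_at i g x * v x)" for i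
    using continuous_on_zero_extension[OF \<Omega> K smooth_onD(1)[OF g] C1_withD(2)[OF v(1)] v0]
      continuous_on_zero_extension[OF \<Omega> K smooth_onD(1)[OF smooth_onD(3)[OF g]] C1_withD(3)[OF v(1)] v(2)]
    by (intro continuous_on_add) auto
  fix x
  show "((\<lambda>x. indicator \<Omega> x * g x * v x) has_derivative
      (\<lambda>w. \<Sum>i\<in>UNIV. w $ i * (indicator \<Omega> x * g x * v' i x + indicator \<Omega> x * pderiv_at i g x * v x))) (at x)"
  proof (cases "x \<in> \<Omega>")
    case True
    have "((\<lambda>x. g x * v x) has_derivative
        (\<lambda>w. \<Sum>i\<in>UNIV. w $ i * (g x * v' i x + pderiv_at i g x * v x))) (at x)"
      by (rule has_derivative_eq_rhs[OF has_derivative_mult[OF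
            has_derivative_pderiv_at[OF smooth_onD(2)[OF g True]] C1_withD(1)[OF v(1)]]])
        (simp add: fun_eq_iff sum_distrib_left sum_distrib_right sum.distrib algebra_simps)
    then have "((\<lambda>x. indicator \<Omega> x * g x * v x) has_derivative
        (\<lambda>w. \<Sum>i\<in>UNIV. w $ i * (g x * v' i x + pderiv_at i g x * v x))) (at x)"
      by (rule has_derivative_transform_within_open[OF _ \<Omega> True]) auto
    then show ?thesis using True by simp
  next
    case False
    then have "x \<notin> K" using K by auto
    have "((\<lambda>x. indicator \<Omega> x * g x * v x) has_derivative (\<lambda>w. 0)) (at x)"
      by (rule has_derivative_transform_within_open[of "\<lambda>_. 0" _ _ _ "-K"])
        (use \<open>x \<notin> K\<close> K v(2) in auto)
    then show ?thesis using False by simp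
  qed
qed

text \<open>The divergence theorem for the field v grad \<phi>, called F in the proof: its
  divergence is grad \<phi> . grad v + v laplacian \<phi> and integrates to zero. The support of v
  stays inside \<Omega>, so no boundary values of \<phi> enter.\<close>

lemma weak_eigenvalue_equation:
  fixes \<phi> :: "real^'n \<Rightarrow> real"
  assumes \<Omega>: "open \<Omega>" and \<phi>: "smooth_on \<Omega> \<phi>" "\<And>x. x \<in> \<Omega> \<Longrightarrow> - laplacian \<phi> x = lam * \<phi> x"
    and K: "compact K" "K \<subseteq> \<Omega>" and v: "C1_with v v'" "\<And>x. x \<notin> K \<Longrightarrow> v x = 0"
  shows "integrable lborel (\<lambda>x. \<Sum>i\<in>UNIV. indicator \<Omega> x * pderiv_at i \<phi> x * v' i x)"
    "(LINT x|lborel. (\<Sum>i\<in>UNIV. indicator \<Omega> x * pderiv_at i \<phi> x * v' i x))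
    = lam * (LINT x|lborel. indicator \<Omega> x * \<phi> x * v x)"
proof -
  define F where "F i x = indicator \<Omega> x * pderiv_at i \<phi> x * v x" for i x
  define F' where "F' i j x = indicator \<Omega> x * pderiv_at i \<phi> x * v' j x
      + indicator \<Omega> x * pderiv_at j (pderiv_at i \<phi>) x * v x" for i j x
  note v0 = C1_with_eq_0_outside[OF v(1) compact_imp_closed[OF K(1)] v(2)]
  have F: "C1_with (F i) (F' i)" for i
    unfolding F_def F'_def
    by (rule C1_with_zero_extension[OF \<Omega> compact_imp_closed[OF K(1)] K(2) smooth_onD(3)[OF \<phi>(1)] v])
  have "x \<notin> K \<Longrightarrow> F i x = 0" "x \<notin> K \<Longrightarrow> F' i j x = 0" for i j x
    using v(2) v0 by (auto simp: F_def F'_def)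
  then have 1: "integrable lborel (F' i i)" "(LINT x|lborel. F' i i x) = 0" for i
    using integral_partial_derivative_eq_0[OF F K(1)] by blast+
  have 2: "integrable lborel (\<lambda>x. indicator \<Omega> x * pderiv_at i \<phi> x * v' i x)" for i
    by (rule integrable_compact_support[OF continuous_on_zero_extension[OF \<Omega> compact_imp_closed[OF K(1)] K(2)
          smooth_onD(1)[OF smooth_onD(3)[OF \<phi>(1)]] C1_withD(2)[OF v(1)] v0] K(1)])
      (auto simp: v0)
  have 3: "(\<Sum>i\<in>UNIV. F' i i x) = (\<Sum>i\<in>UNIV. indicator \<Omega> x * pderiv_at i \<phi> x * v' i x)
      - lam * (indicator \<Omega> x * \<phi> x * v x)" for x
  proof -
    have "(\<Sum>i\<in>UNIV. F' i i x) = (\<Sum>i\<in>UNIV. indicator \<Omega> x * pderiv_at i \<phi> x * v' i x)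
        + indicator \<Omega> x * laplacian \<phi> x * v x"
      by (simp add: F'_def sum.distrib laplacian_def sum_distrib_left sum_distrib_right)
    also have "indicator \<Omega> x * laplacian \<phi> x * v x = - (lam * (indicator \<Omega> x * \<phi> x * v x))"
    proof (cases "x \<in> \<Omega>")
      case True
      then have "laplacian \<phi> x = - (lam * \<phi> x)" using \<phi>(2)[of x] by linarith
      then show ?thesis by simp
    qed simp
    finally show ?thesis by simp
  qed
  have 4: "integrable lborel (\<lambda>x. lam * (indicator \<Omega> x * \<phi> x * v x))"
  proof (rule integrable_mult_right)
    show "integrable lborel (\<lambda>x. indicator \<Omega> x * \<phi> x * v x)"
      by (rule integrable_compact_support[OF continuous_on_zero_extension[OF \<Omega> compact_imp_closed[OF K(1)] K(2)
            smooth_onD(1)[OF \<phi>(1)] C1_withD(3)[OF v(1)] v(2)] K(1)]) (auto simp: v(2))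
  qed
  have "0 = (LINT x|lborel. (\<Sum>i\<in>UNIV. F' i i x))"
    using 1 by simp
  also have "\<dots> = (LINT x|lborel. (\<Sum>i\<in>UNIV. indicator \<Omega> x * pderiv_at i \<phi> x * v' i x))
      - (LINT x|lborel. lam * (indicator \<Omega> x * \<phi> x * v x))"
    unfolding 3 using 2 4 by (intro Bochner_Integration.integral_diff Bochner_Integration.integrable_sum)
  finally show "(LINT x|lborel. (\<Sum>i\<in>UNIV. indicator \<Omega> x * pderiv_at i \<phi> x * v' i x))
    = lam * (LINT x|lborel. indicator \<Omega> x * \<phi> x * v x)" by simp
  show "integrable lborel (\<lambda>x. \<Sum>i\<in>UNIV. indicator \<Omega> x * pderiv_at i \<phi> x * v' i x)"
    using 2 by simp
qed

section \<open>Ground states as weak subsolutions\<close>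

lemma integrable_mult_L2:
  fixes f g :: "'a \<Rightarrow> real"
  assumes [measurable]: "f \<in> borel_measurable M" "g \<in> borel_measurable M"
    and "integrable M (\<lambda>x. (f x)\<^sup>2)" "integrable M (\<lambda>x. (g x)\<^sup>2)"
  shows "integrable M (\<lambda>x. f x * g x)"
proof (rule Bochner_Integration.integrable_bound)
  show "integrable M (\<lambda>x. (f x)\<^sup>2 + (g x)\<^sup>2)" using assms by auto
  have "\<bar>a * b\<bar> \<le> a\<^sup>2 + b\<^sup>2" for a b :: real
  proof -
    have "0 \<le> (\<bar>a\<bar> - \<bar>b\<bar>)\<^sup>2 + \<bar>a\<bar> * \<bar>b\<bar>" by simp
    then show ?thesis by (simp add: abs_mult power2_diff)
  qed
  then show "AE x in M. norm (f x * g x) \<le> norm ((f x)\<^sup>2 + (g x)\<^sup>2)" by simp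
qed auto

text \<open>Used to pass to the limit along the approximating test functions. The error is a fixed
  square-integrable h times a null sequence in L2; the role of Cauchy-Schwarz is taken by |a| |b| <=
  q a^2 + b^2 / q with a free parameter q.\<close>

lemma L2_tendsto_integral:
  fixes f :: "'a \<Rightarrow> real"
  assumes [measurable]: "h \<in> borel_measurable M" "\<And>k. d k \<in> borel_measurable M"
      "\<And>k. fs k \<in> borel_measurable M"
    and h: "integrable M (\<lambda>x. (h x)\<^sup>2)" and d: "\<And>k. integrable M (\<lambda>x. (d k x)\<^sup>2)"
      "(\<lambda>k. LINT x|M. (d k x)\<^sup>2) \<longlonglongrightarrow> 0"
    and f: "integrable M f"
    and bd: "\<And>k x. x \<in> space M \<Longrightarrow> \<bar>fs k x - f x\<bar> \<le> C * (\<bar>h x\<bar> * \<bar>d k x\<bar>)"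
  shows "integrable M (fs k)" "(\<lambda>k. LINT x|M. fs k x) \<longlonglongrightarrow> (LINT x|M. f x)"
proof -
  have [measurable]: "f \<in> borel_measurable M" using f by auto
  have hd: "integrable M (\<lambda>x. \<bar>h x\<bar> * \<bar>d k x\<bar>)" for k
    using integrable_mult_L2[of "\<lambda>x. \<bar>h x\<bar>" M "\<lambda>x. \<bar>d k x\<bar>"] h d by simp
  have "integrable M (\<lambda>x. C * (\<bar>h x\<bar> * \<bar>d k x\<bar>))" for k
    using hd by simp
  then have diff: "integrable M (\<lambda>x. fs k x - f x)" for k
  proof (rule Bochner_Integration.integrable_bound)
    show "AE x in M. norm (fs k x - f x) \<le> norm (C * (\<bar>h x\<bar> * \<bar>d k x\<bar>))"
    proof (rule AE_I2)
      fix x assume "x \<in> space M"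
      from bd[OF this, of k] show "norm (fs k x - f x) \<le> norm (C * (\<bar>h x\<bar> * \<bar>d k x\<bar>))" by simp
    qed
  qed simp
  from Bochner_Integration.integrable_add[OF this f] show int: "integrable M (fs k)" for k by simp
  have bound: "\<bar>(LINT x|M. fs k x) - (LINT x|M. f x)\<bar> \<le> \<bar>C\<bar> * (LINT x|M. \<bar>h x\<bar> * \<bar>d k x\<bar>)" for k
  proof -
    have "\<bar>(LINT x|M. fs k x) - (LINT x|M. f x)\<bar> = \<bar>LINT x|M. fs k x - f x\<bar>"
      using int f by simp
    also have "\<dots> \<le> (LINT x|M. \<bar>fs k x - f x\<bar>)"
      using integral_norm_bound[of M "\<lambda>x. fs k x - f x"] by simp
    also have "\<dots> \<le> (LINT x|M. \<bar>C\<bar> * (\<bar>h x\<bar> * \<bar>d k x\<bar>))"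
    proof (rule integral_mono)
      fix x assume "x \<in> space M"
      then have "\<bar>fs k x - f x\<bar> \<le> C * (\<bar>h x\<bar> * \<bar>d k x\<bar>)" using bd by blast
      also have "\<dots> \<le> \<bar>C\<bar> * (\<bar>h x\<bar> * \<bar>d k x\<bar>)" by (rule mult_right_mono) auto
      finally show "\<bar>fs k x - f x\<bar> \<le> \<bar>C\<bar> * (\<bar>h x\<bar> * \<bar>d k x\<bar>)" .
    qed (use diff hd in auto)
    finally show ?thesis using hd[of k] by simp
  qed
  have "(\<lambda>k. LINT x|M. \<bar>h x\<bar> * \<bar>d k x\<bar>) \<longlonglongrightarrow> 0"
  proof (rule LIMSEQ_I)
    fix e :: real assume "e > 0"
    define H where "H = (LINT x|M. (h x)\<^sup>2)"
    have "H \<ge> 0" by (simp add: H_def)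
    \<comment> \<open>q keeps the fixed term q H below e / 2, where the + 1 covers H = 0; the other
      half comes from \<open>d k\<close> for large k.\<close>
    define q where "q = e / (2 * (H + 1))"
    have q: "q > 0" using \<open>e > 0\<close> \<open>H \<ge> 0\<close> by (simp add: q_def)
    have qH: "q * H < e / 2"
    proof -
      have "q * H < q * (H + 1)" using q by simp
      also have "\<dots> = e / 2" using \<open>H \<ge> 0\<close> by (simp add: q_def field_simps)
      finally show ?thesis .
    qed
    have "eventually (\<lambda>k. (LINT x|M. (d k x)\<^sup>2) < q * e / 2) sequentially"
      using q \<open>e > 0\<close> by (intro order_tendstoD(2)[OF d(2)]) auto
    then obtain N where N: "\<And>k. k \<ge> N \<Longrightarrow> (LINT x|M. (d k x)\<^sup>2) < q * e / 2"
      by (auto simp: eventually_sequentially)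
    have "norm ((LINT x|M. \<bar>h x\<bar> * \<bar>d k x\<bar>) - 0) < e" if "k \<ge> N" for k
    proof -
      have am: "\<bar>a\<bar> * \<bar>b\<bar> \<le> q * a\<^sup>2 + b\<^sup>2 / q" for a b :: real
      proof -
        have "0 \<le> (q * \<bar>a\<bar> - \<bar>b\<bar>)\<^sup>2 + q * (\<bar>a\<bar> * \<bar>b\<bar>)" using q by simp
        then have "q * (\<bar>a\<bar> * \<bar>b\<bar>) \<le> q * (q * a\<^sup>2 + b\<^sup>2 / q)"
          using q by (simp add: power2_eq_square algebra_simps)
        then show ?thesis using q by simp
      qed
      have "(LINT x|M. \<bar>h x\<bar> * \<bar>d k x\<bar>) \<le> (LINT x|M. q * (h x)\<^sup>2 + (d k x)\<^sup>2 / q)"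
        using hd h d am by (intro integral_mono) auto
      also have "\<dots> = q * H + (LINT x|M. (d k x)\<^sup>2) / q"
        using h d by (simp add: H_def)
      also have "\<dots> < e / 2 + e / 2"
        using qH N[OF that] q by (intro add_strict_mono) (auto simp: field_simps)
      finally show ?thesis by simp
    qed
    then show "\<exists>N. \<forall>k\<ge>N. norm ((LINT x|M. \<bar>h x\<bar> * \<bar>d k x\<bar>) - 0) < e" by blast
  qed
  then have "(\<lambda>k. \<bar>C\<bar> * (LINT x|M. \<bar>h x\<bar> * \<bar>d k x\<bar>)) \<longlonglongrightarrow> 0"
    by (rule tendsto_mult_right_zero)
  then have "(\<lambda>k. (LINT x|M. fs k x) - (LINT x|M. f x)) \<longlonglongrightarrow> 0"
    by (rule Lim_null_comparison[rotated]) (use bound in auto)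
  then show "(\<lambda>k. LINT x|M. fs k x) \<longlonglongrightarrow> (LINT x|M. f x)"
    by (simp add: LIM_zero_iff)
qed

text \<open>\<open>fin\<close> is a separate hypothesis because a sequence in \<open>ennreal\<close>
  that tends to 0 may still have infinite early terms, for which the square need not be
  integrable.\<close>

lemma L2_null_sequence:
  fixes a :: "nat \<Rightarrow> 'a \<Rightarrow> real"
  assumes [measurable]: "\<And>k. a k \<in> borel_measurable M"
    and le: "\<And>k. (\<integral>\<^sup>+x. ennreal ((a k x)\<^sup>2) \<partial>M) \<le> N k" and fin: "\<And>k. N k < \<infinity>" and N: "N \<longlonglongrightarrow> 0"
  shows "integrable M (\<lambda>x. (a k x)\<^sup>2)" "(\<lambda>k. LINT x|M. (a k x)\<^sup>2) \<longlonglongrightarrow> 0"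
proof -
  show i: "integrable M (\<lambda>x. (a k x)\<^sup>2)" for k
    using le_less_trans[OF le fin] by (intro integrableI_bounded) auto
  have "(\<lambda>k. ennreal (LINT x|M. (a k x)\<^sup>2)) \<longlonglongrightarrow> 0"
  proof (rule tendsto_sandwich[OF _ _ tendsto_const N])
    show "\<forall>\<^sub>F k in sequentially. ennreal (LINT x|M. (a k x)\<^sup>2) \<le> N k"
      using le by (simp add: nn_integral_eq_integral[OF i])
  qed simp
  then have "(\<lambda>k. ennreal (LINT x|M. (a k x)\<^sup>2)) \<longlonglongrightarrow> ennreal 0" by simp
  then show "(\<lambda>k. LINT x|M. (a k x)\<^sup>2) \<longlonglongrightarrow> 0"
    by (rule tendsto_ennrealD) auto
qed

lemma test_fun_C1_with:
  assumes "test_fun \<Omega> u"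
  obtains K where "compact K" "K \<subseteq> \<Omega>" "\<And>x. x \<notin> K \<Longrightarrow> u x = 0" "\<And>i x. x \<notin> K \<Longrightarrow> pderiv_at i u x = 0"
    "C1_with u (\<lambda>i. pderiv_at i u)"
proof
  let ?K = "closure {x. u x \<noteq> 0}"
  show C: "C1_with u (\<lambda>i. pderiv_at i u)" using assms by (auto simp: test_fun_def intro: C1_with_smooth_on)
  show "compact ?K" "?K \<subseteq> \<Omega>" using assms by (auto simp: test_fun_def)
  show z: "u x = 0" if "x \<notin> ?K" for x using that closure_subset[of "{x. u x \<noteq> 0}"] by auto
  show "pderiv_at i u x = 0" if "x \<notin> ?K" for i x
    using C1_with_eq_0_outside[OF C closed_closure z that] .
qed

lemma borel_measurable_indicator_smooth:
  assumes "open \<Omega>" "smooth_on \<Omega> g"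
  shows "(\<lambda>x. indicator \<Omega> x * g x) \<in> borel_measurable borel"
  using borel_measurable_continuous_on_indicator[OF _ smooth_onD(1)[OF assms(2)]] assms(1) by simp

text \<open>Turns \<open>in_H10\<close> into L2 convergence on the whole space, separately for the
  function and each partial derivative, with Bochner integrals. Passing from \<Omega> to the whole
  space costs nothing, as the test functions are supported inside \<Omega>.\<close>

lemma in_H10_approximation:
  fixes \<phi> :: "real^'n \<Rightarrow> real"
  assumes \<Omega>: "open \<Omega>" and \<phi>: "smooth_on \<Omega> \<phi>" "in_H10 \<Omega> \<phi>"
  obtains u where "\<And>k::nat. test_fun \<Omega> (u k)"
    "\<And>k. integrable lborel (\<lambda>x. (u k x - indicator \<Omega> x * \<phi> x)\<^sup>2)"
    "(\<lambda>k. LINT x|lborel. (u k x - indicator \<Omega> x * \<phi> x)\<^sup>2) \<longlonglongrightarrow> 0"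
    "\<And>i k. integrable lborel (\<lambda>x. (pderiv_at i (u k) x - indicator \<Omega> x * pderiv_at i \<phi> x)\<^sup>2)"
    "\<And>i. (\<lambda>k. LINT x|lborel. (pderiv_at i (u k) x - indicator \<Omega> x * pderiv_at i \<phi> x)\<^sup>2) \<longlonglongrightarrow> 0"
proof -
  obtain u where u: "\<And>k::nat. test_fun \<Omega> (u k)"
    and lim: "(\<lambda>k. \<integral>\<^sup>+x\<in>\<Omega>. ennreal ((\<phi> x - u k x)\<^sup>2 + (norm (grad \<phi> x - grad (u k) x))\<^sup>2) \<partial>lebesgue)
       \<longlonglongrightarrow> 0"
    using \<phi>(2) by (auto simp: in_H10_def)
  define a where "a k x = u k x - indicator \<Omega> x * \<phi> x" for k x
  define b where "b i k x = pderiv_at i (u k) x - indicator \<Omega> x * pderiv_at i \<phi> x" for i k x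
  define N where "N k = (\<integral>\<^sup>+x. ennreal ((a k x)\<^sup>2 + (\<Sum>i\<in>UNIV. (b i k x)\<^sup>2)) \<partial>lborel)" for k
  have C: "C1_with (u k) (\<lambda>i. pderiv_at i (u k))" for k
    using u[of k] by (auto simp: test_fun_def intro: C1_with_smooth_on)
  have am [measurable]: "a k \<in> borel_measurable borel" for k
    unfolding a_def using C1_withD(3)[OF C[of k]] borel_measurable_indicator_smooth[OF \<Omega> \<phi>(1)]
    by (intro borel_measurable_diff) (simp_all add: borel_measurable_continuous_onI)
  have bm [measurable]: "b i k \<in> borel_measurable borel" for i k
    unfolding b_def using C1_withD(2)[OF C[of k]] borel_measurable_indicator_smooth[OF \<Omega> smooth_onD(3)[OF \<phi>(1)]]
    by (intro borel_measurable_diff) (simp_all add: borel_measurable_continuous_onI)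
  have "(\<integral>\<^sup>+x\<in>\<Omega>. ennreal ((\<phi> x - u k x)\<^sup>2 + (norm (grad \<phi> x - grad (u k) x))\<^sup>2) \<partial>lebesgue) = N k" for k
  proof -
    obtain K where K: "K \<subseteq> \<Omega>" "\<And>x. x \<notin> K \<Longrightarrow> u k x = 0" "\<And>i x. x \<notin> K \<Longrightarrow> pderiv_at i (u k) x = 0"
      using test_fun_C1_with[OF u[of k]] by metis
    have "ennreal ((\<phi> x - u k x)\<^sup>2 + (norm (grad \<phi> x - grad (u k) x))\<^sup>2) * indicator \<Omega> x
        = ennreal ((a k x)\<^sup>2 + (\<Sum>i\<in>UNIV. (b i k x)\<^sup>2))" for x
    proof (cases "x \<in> \<Omega>")
      case True
      have "(norm (grad \<phi> x - grad (u k) x))\<^sup>2 = (\<Sum>i\<in>UNIV. (pderiv_at i (u k) x - pderiv_at i \<phi> x)\<^sup>2)"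
        by (simp add: power2_norm_eq_inner inner_vec_def grad_def power2_eq_square[symmetric] power2_commute)
      then show ?thesis using True by (simp add: a_def b_def power2_commute)
    next
      case False
      then have "x \<notin> K" using K by auto
      then show ?thesis using False K by (simp add: a_def b_def)
    qed
    then have "(\<integral>\<^sup>+x\<in>\<Omega>. ennreal ((\<phi> x - u k x)\<^sup>2 + (norm (grad \<phi> x - grad (u k) x))\<^sup>2) \<partial>lebesgue)
        = (\<integral>\<^sup>+x. ennreal ((a k x)\<^sup>2 + (\<Sum>i\<in>UNIV. (b i k x)\<^sup>2)) \<partial>lebesgue)"
      by simp
    also have "\<dots> = N k"
      unfolding N_def by (rule nn_integral_completion)
    finally show ?thesis .
  qed
  with lim have N: "N \<longlonglongrightarrow> 0" by simp
  \<comment> \<open>Early terms of N may be infinite, so the approximating sequence is made to start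
    at k0.\<close>
  then have "\<forall>\<^sub>F k in sequentially. N k < 1"
    by (rule order_tendstoD) simp
  then obtain k0 where k0: "\<And>k. k \<ge> k0 \<Longrightarrow> N k < 1"
    by (auto simp: eventually_sequentially)
  have fin: "N (k + k0) < \<infinity>" for k
    using k0[of "k + k0"] by (simp add: less_trans)
  have N': "(\<lambda>k. N (k + k0)) \<longlonglongrightarrow> 0"
    using N by (rule LIMSEQ_ignore_initial_segment)
  have leN: "(\<integral>\<^sup>+x. ennreal ((a k x)\<^sup>2) \<partial>lborel) \<le> N k" "(\<integral>\<^sup>+x. ennreal ((b i k x)\<^sup>2) \<partial>lborel) \<le> N k" for i k
  proof -
    show "(\<integral>\<^sup>+x. ennreal ((a k x)\<^sup>2) \<partial>lborel) \<le> N k"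
      unfolding N_def by (intro nn_integral_mono ennreal_leI) (simp add: sum_nonneg)
    have "(b i k x)\<^sup>2 \<le> (a k x)\<^sup>2 + (\<Sum>i\<in>UNIV. (b i k x)\<^sup>2)" for x
      using member_le_sum[of i UNIV "\<lambda>i. (b i k x)\<^sup>2"] by (simp add: add_increasing)
    then show "(\<integral>\<^sup>+x. ennreal ((b i k x)\<^sup>2) \<partial>lborel) \<le> N k"
      unfolding N_def by (intro nn_integral_mono ennreal_leI)
  qed
  show thesis
  proof (rule that[of "\<lambda>k. u (k + k0)"])
    show "test_fun \<Omega> (u (k + k0))" for k by (rule u)
    note A = L2_null_sequence[of "\<lambda>k. a (k + k0)" lborel, OF _ leN(1) fin N']
    note B = L2_null_sequence[of "\<lambda>k. b i (k + k0)" lborel for i, OF _ leN(2) fin N']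
    show "integrable lborel (\<lambda>x. (u (k + k0) x - indicator \<Omega> x * \<phi> x)\<^sup>2)" for k
      using A(1)[of k] by (simp add: a_def)
    show "(\<lambda>k. LINT x|lborel. (u (k + k0) x - indicator \<Omega> x * \<phi> x)\<^sup>2) \<longlonglongrightarrow> 0"
      using A(2) by (simp add: a_def)
    show "integrable lborel (\<lambda>x. (pderiv_at i (u (k + k0)) x - indicator \<Omega> x * pderiv_at i \<phi> x)\<^sup>2)" for i k
      using B(1)[of i k] by (simp add: b_def)
    show "(\<lambda>k. LINT x|lborel. (pderiv_at i (u (k + k0)) x - indicator \<Omega> x * pderiv_at i \<phi> x)\<^sup>2) \<longlonglongrightarrow> 0" for i
      using B(2)[of i] by (simp add: b_def)
  qed
qed

lemma arctan_mult_lipschitz: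
  fixes m s t :: real
  assumes "m \<ge> 0"
  shows "\<bar>arctan (m * s) - arctan (m * t)\<bar> \<le> m * \<bar>s - t\<bar>"
proof -
  have "norm (arctan (m * s) - arctan (m * t)) \<le> 1 * norm (m * s - m * t)"
  proof (rule field_differentiable_bound[of UNIV arctan "\<lambda>x. inverse (1 + x\<^sup>2)"])
    show "norm (inverse (1 + x\<^sup>2)) \<le> 1" for x :: real
      by (simp add: inverse_le_1_iff)
  qed (auto intro: DERIV_arctan)
  also have "\<dots> = m * \<bar>s - t\<bar>"
    using assms by (simp add: right_diff_distrib[symmetric] abs_mult)
  finally show ?thesis by simp
qed

lemma square_integrable_of_approx:
  fixes f g :: "'a \<Rightarrow> real"
  assumes [measurable]: "f \<in> borel_measurable M" "g \<in> borel_measurable M"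
    and "integrable M (\<lambda>x. (f x)\<^sup>2)" "integrable M (\<lambda>x. (f x - g x)\<^sup>2)"
  shows "integrable M (\<lambda>x. (g x)\<^sup>2)"
proof (rule Bochner_Integration.integrable_bound)
  show "integrable M (\<lambda>x. 2 * (f x)\<^sup>2 + 2 * (f x - g x)\<^sup>2)" using assms by auto
  have "b\<^sup>2 \<le> 2 * a\<^sup>2 + 2 * (a - b)\<^sup>2" for a b :: real
  proof -
    have "0 \<le> (2 * a - b)\<^sup>2" by simp
    then show ?thesis by (simp add: power2_eq_square algebra_simps)
  qed
  then show "AE x in M. norm ((g x)\<^sup>2) \<le> norm (2 * (f x)\<^sup>2 + 2 * (f x - g x)\<^sup>2)" by simp
qed auto

text \<open>The equation is tested with \<open>\<eta> * arctan (m * u k)\<close>, where the test functions \<open>u k\<close> approximate \<open>\<phi>\<close>;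
  this needs no regularity of the boundary. The term that contains the derivative of the arctangent
  is nonnegative up to an error that vanishes as \<open>k\<close> tends to infinity. Afterwards \<open>m\<close> tends to
  infinity, where the arctangent becomes the constant \<open>pi / 2\<close> because \<open>\<phi>\<close> is positive.\<close>

lemma weak_subsolution:
  fixes \<phi> :: "real^'n \<Rightarrow> real"
  assumes \<Omega>: "open \<Omega>" "bounded \<Omega>" and \<phi>: "smooth_on \<Omega> \<phi>" "in_H10 \<Omega> \<phi>"
      "\<And>x. x \<in> \<Omega> \<Longrightarrow> \<phi> x > 0" "\<And>x. x \<in> \<Omega> \<Longrightarrow> - laplacian \<phi> x = lam * \<phi> x"
    and \<eta>: "C1_with \<eta> \<eta>'" "\<And>i. C1_with (\<eta>' i) (\<eta>'' i)" "\<And>x. \<eta> x \<ge> 0"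
  shows "integrable lborel (\<lambda>x. indicator \<Omega> x * \<phi> x)"
    "- lam * (LINT x|lborel. indicator \<Omega> x * \<phi> x * \<eta> x)
      \<le> (LINT x|lborel. indicator \<Omega> x * \<phi> x * (\<Sum>i\<in>UNIV. \<eta>'' i i x))"
proof -
  define f where "f x = indicator \<Omega> x * \<phi> x" for x
  define g where "g i x = indicator \<Omega> x * pderiv_at i \<phi> x" for i x
  obtain u where u: "\<And>k::nat. test_fun \<Omega> (u k)"
    "\<And>k. integrable lborel (\<lambda>x. (u k x - f x)\<^sup>2)"
    "(\<lambda>k. LINT x|lborel. (u k x - f x)\<^sup>2) \<longlonglongrightarrow> 0"
    "\<And>i k. integrable lborel (\<lambda>x. (pderiv_at i (u k) x - g i x)\<^sup>2)"
    "\<And>i. (\<lambda>k. LINT x|lborel. (pderiv_at i (u k) x - g i x)\<^sup>2) \<longlonglongrightarrow> 0"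
    by (rule in_H10_approximation[OF \<Omega>(1) \<phi>(1,2), folded f_def g_def]) (rule that)
  have [measurable]: "f \<in> borel_measurable borel" "g i \<in> borel_measurable borel" for i
    unfolding f_def[abs_def] g_def[abs_def]
    using borel_measurable_indicator_smooth[OF \<Omega>(1) \<phi>(1)]
      borel_measurable_indicator_smooth[OF \<Omega>(1) smooth_onD(3)[OF \<phi>(1)]] by auto
  have uC: "C1_with (u k) (\<lambda>i. pderiv_at i (u k))" for k
    using u(1)[of k] by (auto simp: test_fun_def intro: C1_with_smooth_on)
  have [measurable]: "u k \<in> borel_measurable borel" "pderiv_at i (u k) \<in> borel_measurable borel" for i k
    using C1_withD[OF uC[of k]] by (auto intro: borel_measurable_continuous_onI)
  have [measurable]: "\<eta> \<in> borel_measurable borel" "\<eta>' i \<in> borel_measurable borel" "\<eta>'' i j \<in> borel_measurable borel" for i j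
    using C1_withD[OF \<eta>(1)] C1_withD[OF \<eta>(2)] by (auto intro: borel_measurable_continuous_onI)
  have [measurable]: "\<Omega> \<in> sets borel" using \<Omega>(1) by auto
  have u0: "x \<notin> \<Omega> \<Longrightarrow> u k x = 0" for k x
    using test_fun_C1_with[OF u(1)[of k]] by (metis subsetD)
  have f0: "x \<notin> \<Omega> \<Longrightarrow> f x = 0" and g0: "x \<notin> \<Omega> \<Longrightarrow> g i x = 0" for x i
    by (auto simp: f_def g_def)
  have fpos: "f x \<ge> 0" for x using \<phi>(3)[of x] by (auto simp: f_def split: split_indicator)

  \<comment> \<open>\<eta> and its derivatives are bounded on the compact closure of \<Omega>, and
    every integrand below has a factor that vanishes outside \<Omega>. So \<eta> may be any function
    on the whole space, without decay at infinity.\<close>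
  have "\<exists>B\<ge>0. \<forall>x\<in>\<Omega>. \<bar>\<psi> x\<bar> \<le> B" if "continuous_on UNIV \<psi>" for \<psi> :: "real^'n \<Rightarrow> real"
  proof -
    have "bounded (\<psi> ` closure \<Omega>)"
      using continuous_on_subset[OF that subset_UNIV] \<Omega>(2)
      by (auto intro!: compact_imp_bounded compact_continuous_image)
    then obtain B where "\<And>x. x \<in> closure \<Omega> \<Longrightarrow> \<bar>\<psi> x\<bar> \<le> B"
      unfolding bounded_iff by auto
    then have "\<forall>x\<in>\<Omega>. \<bar>\<psi> x\<bar> \<le> \<bar>B\<bar>" using closure_subset[of \<Omega>] by fastforce
    then show ?thesis by (intro exI[of _ "\<bar>B\<bar>"]) auto
  qed
  note bdd = this
  obtain B where B: "B \<ge> 0" "\<And>x. x \<in> \<Omega> \<Longrightarrow> \<bar>\<eta> x\<bar> \<le> B"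
    using bdd[OF C1_withD(3)[OF \<eta>(1)]] by auto
  obtain B1 where B1: "\<And>i. B1 i \<ge> 0" "\<And>i x. x \<in> \<Omega> \<Longrightarrow> \<bar>\<eta>' i x\<bar> \<le> B1 i"
    using bdd[OF C1_withD(2)[OF \<eta>(1)]] by metis
  obtain B2 where B2: "\<And>i. B2 i \<ge> 0" "\<And>i x. x \<in> \<Omega> \<Longrightarrow> \<bar>\<eta>'' i i x\<bar> \<le> B2 i"
  proof -
    have "\<forall>i. \<exists>B\<ge>0. \<forall>x\<in>\<Omega>. \<bar>\<eta>'' i i x\<bar> \<le> B"
      using bdd[OF C1_withD(2)[OF \<eta>(2)]] by blast
    then show thesis using that by metis
  qed

  have f2: "integrable lborel (\<lambda>x. (f x)\<^sup>2)"
  proof (rule square_integrable_of_approx[of "u 0"])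
    obtain K where K: "compact K" "\<And>x. x \<notin> K \<Longrightarrow> u 0 x = 0" using test_fun_C1_with[OF u(1)] by metis
    show "integrable lborel (\<lambda>x. (u 0 x)\<^sup>2)"
      by (rule integrable_compact_support[OF _ K(1)])
        (use K C1_withD(3)[OF uC] in \<open>auto intro!: continuous_intros\<close>)
  qed (use u in auto)
  have g2: "integrable lborel (\<lambda>x. (g i x)\<^sup>2)" for i
  proof (rule square_integrable_of_approx[of "pderiv_at i (u 0)"])
    obtain K where K: "compact K" "\<And>x. x \<notin> K \<Longrightarrow> pderiv_at i (u 0) x = 0" using test_fun_C1_with[OF u(1)] by metis
    show "integrable lborel (\<lambda>x. (pderiv_at i (u 0) x)\<^sup>2)"
      by (rule integrable_compact_support[OF _ K(1)])
        (use K C1_withD(2)[OF uC] in \<open>auto intro!: continuous_intros\<close>)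
  qed (use u in auto)
  have ind: "integrable lborel (\<lambda>x. (indicator \<Omega> x :: real)\<^sup>2)"
    using emeasure_bounded_finite[OF \<Omega>(2)] by (simp add: power2_eq_square flip: indicator_inter_arith)
  have L1: "integrable lborel h" if [measurable]: "h \<in> borel_measurable borel"
    and "integrable lborel (\<lambda>x. (h x)\<^sup>2)" "\<And>x. x \<notin> \<Omega> \<Longrightarrow> h x = 0" for h :: "real^'n \<Rightarrow> real"
  proof -
    have "integrable lborel (\<lambda>x. h x * indicator \<Omega> x)"
      by (rule integrable_mult_L2) (use that ind in auto)
    moreover have "(\<lambda>x. h x * indicator \<Omega> x) = h" using that(3) by (auto split: split_indicator)
    ultimately show ?thesis by simp
  qed
  have f1: "integrable lborel f" by (rule L1[OF _ f2 f0]) measurable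
  then show "integrable lborel (\<lambda>x. indicator \<Omega> x * \<phi> x)" by (simp add: f_def[abs_def])
  have g1: "integrable lborel (g i)" for i by (rule L1[OF _ g2 g0]) measurable
  have bm: "integrable lborel (\<lambda>x. h x * b x)" if "integrable lborel h" "\<And>x. x \<notin> \<Omega> \<Longrightarrow> h x = 0"
    "b \<in> borel_measurable borel" "\<And>x. x \<in> \<Omega> \<Longrightarrow> \<bar>b x\<bar> \<le> c" for h b :: "real^'n \<Rightarrow> real" and c
  proof (rule Bochner_Integration.integrable_bound)
    show "integrable lborel (\<lambda>x. c * h x)" using that by auto
    have "\<bar>h x * b x\<bar> \<le> \<bar>c * h x\<bar>" for x
      using that(2)[of x] that(4)[of x] mult_right_mono[of "\<bar>b x\<bar>" "\<bar>c\<bar>" "\<bar>h x\<bar>"]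
      by (cases "x \<in> \<Omega>") (auto simp: abs_mult mult.commute)
    then show "AE x in lborel. norm (h x * b x) \<le> norm (c * h x)" by simp
    show "(\<lambda>x. h x * b x) \<in> borel_measurable lborel"
      using borel_measurable_integrable[OF that(1)] that(3) by auto
  qed
  have at_bd: "\<bar>arctan y\<bar> \<le> 2" for y
    using arctan_ubound[of y] arctan_lbound[of y] pi_less_4 by linarith

  have step1: "(\<Sum>i\<in>UNIV. LINT x|lborel. g i x * (\<eta>' i x * arctan (m * f x)))
      \<le> lam * (LINT x|lborel. f x * (\<eta> x * arctan (m * f x)))" if m: "m > 0" for m :: real
  proof -
    define D where "D k x = m / (1 + (m * u k x)\<^sup>2)" for k x
    have D: "0 \<le> D k x" "D k x \<le> m" for k x
      unfolding D_def using m divide_left_mono[of 1 "1 + (m * u k x)\<^sup>2" m]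
        add_pos_nonneg[OF zero_less_one zero_le_power2[of "m * u k x"]] by auto
    have [measurable]: "D k \<in> borel_measurable borel" for k unfolding D_def by measurable
    \<comment> \<open>P comes from the derivative of \<eta>. In the term with the derivative
      \<open>D k\<close> of the arctangent, \<open>pderiv_at i (u k)\<close> is split into
      \<open>g i\<close> plus an error: the first piece is g^2 \<eta> D >= 0 and is dropped in
      \<open>key\<close>, the second is Q. Since \<open>D k\<close> is bounded only by m, Q vanishes
      in the limit for fixed m; this is why k tends to infinity before m does.\<close>
    define P where "P i k x = g i x * (\<eta>' i x * arctan (m * u k x))" for i k x
    define Q where "Q i k x = g i x * ((pderiv_at i (u k) x - g i x) * (\<eta> x * D k x))" for i k x
    define R where "R k x = f x * (\<eta> x * arctan (m * u k x))" for k x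
    have [measurable]: "P i k \<in> borel_measurable borel" "Q i k \<in> borel_measurable borel"
      "R k \<in> borel_measurable borel" for i k
      unfolding P_def Q_def R_def by measurable
    have arc: "\<bar>w * arctan (m * s) - w * arctan (m * t)\<bar> \<le> (c * m) * \<bar>s - t\<bar>"
      if "\<bar>w\<bar> \<le> c" for w s t c :: real
      unfolding right_diff_distrib[symmetric] abs_mult
      using mult_mono[OF that arctan_mult_lipschitz[of m s t]] m that by (simp add: mult.assoc)
    have P1: "integrable lborel (\<lambda>x. g i x * (\<eta>' i x * arctan (m * f x)))" for i
    proof (rule bm[OF g1 g0, where c="B1 i * 2"])
      show "\<bar>\<eta>' i x * arctan (m * f x)\<bar> \<le> B1 i * 2" if "x \<in> \<Omega>" for x
        unfolding abs_mult using B1(2)[OF that] at_bd B1(1)[of i] by (intro mult_mono) auto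
    qed auto
    have P: "integrable lborel (P i k)"
      "(\<lambda>k. LINT x|lborel. P i k x) \<longlonglongrightarrow> (LINT x|lborel. g i x * (\<eta>' i x * arctan (m * f x)))" for i k
    proof -
      have b: "\<bar>P i k x - g i x * (\<eta>' i x * arctan (m * f x))\<bar> \<le> (B1 i * m) * (\<bar>g i x\<bar> * \<bar>u k x - f x\<bar>)" for k x
      proof (cases "x \<in> \<Omega>")
        case True
        show ?thesis unfolding P_def right_diff_distrib[symmetric] abs_mult[of "g i x"]
          using mult_left_mono[OF arc[OF B1(2)[OF True, of i], of "u k x" "f x"], of "\<bar>g i x\<bar>"]
          by (simp add: algebra_simps)
      qed (simp add: P_def g0)
      show "integrable lborel (P i k)"
        "(\<lambda>k. LINT x|lborel. P i k x) \<longlonglongrightarrow> (LINT x|lborel. g i x * (\<eta>' i x * arctan (m * f x)))"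
        by (rule L2_tendsto_integral[OF _ _ _ g2 u(2,3) P1 b]; measurable)+
    qed
    have Q: "integrable lborel (Q i k)" "(\<lambda>k. LINT x|lborel. Q i k x) \<longlonglongrightarrow> (LINT x|(lborel :: (real^'n) measure). (0::real))" for i k
    proof -
      have b: "\<bar>Q i k x - 0\<bar> \<le> (B * m) * (\<bar>g i x\<bar> * \<bar>pderiv_at i (u k) x - g i x\<bar>)" for k x
      proof (cases "x \<in> \<Omega>")
        case True
        have "\<bar>\<eta> x * D k x\<bar> \<le> B * m"
          unfolding abs_mult using B True D[of k x] by (intro mult_mono) auto
        from mult_left_mono[OF this, of "\<bar>g i x\<bar> * \<bar>pderiv_at i (u k) x - g i x\<bar>"] show ?thesis
          by (simp add: Q_def abs_mult mult_ac)
      qed (simp add: Q_def g0)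
      show "integrable lborel (Q i k)" "(\<lambda>k. LINT x|lborel. Q i k x) \<longlonglongrightarrow> (LINT x|(lborel :: (real^'n) measure). (0::real))"
        by (rule L2_tendsto_integral[OF _ _ _ g2 u(4,5) _ b]; measurable)+
    qed
    have R1: "integrable lborel (\<lambda>x. f x * (\<eta> x * arctan (m * f x)))"
    proof (rule bm[OF f1 f0, where c="B * 2"])
      show "\<bar>\<eta> x * arctan (m * f x)\<bar> \<le> B * 2" if "x \<in> \<Omega>" for x
        unfolding abs_mult using B(2)[OF that] at_bd B(1) by (intro mult_mono) auto
    qed auto
    have R: "(\<lambda>k. LINT x|lborel. R k x) \<longlonglongrightarrow> (LINT x|lborel. f x * (\<eta> x * arctan (m * f x)))"
    proof -
      have b: "\<bar>R k x - f x * (\<eta> x * arctan (m * f x))\<bar> \<le> (B * m) * (\<bar>f x\<bar> * \<bar>u k x - f x\<bar>)" for k x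
      proof (cases "x \<in> \<Omega>")
        case True
        show ?thesis unfolding R_def right_diff_distrib[symmetric] abs_mult[of "f x"]
          using mult_left_mono[OF arc[OF B(2)[OF True], of "u k x" "f x"], of "\<bar>f x\<bar>"]
          by (simp add: algebra_simps)
      qed (simp add: R_def f0)
      show ?thesis
        by (rule L2_tendsto_integral(2)[OF _ _ _ f2 u(2,3) R1 b]; measurable)
    qed
    have key: "(\<Sum>i\<in>UNIV. (LINT x|lborel. P i k x) + (LINT x|lborel. Q i k x)) \<le> lam * (LINT x|lborel. R k x)" for k
    proof -
      obtain K where K: "compact K" "K \<subseteq> \<Omega>" "\<And>x. x \<notin> K \<Longrightarrow> u k x = 0"
        using test_fun_C1_with[OF u(1)[of k]] by metis
      have "((\<lambda>s. arctan (m * s)) has_real_derivative m / (1 + (m * s)\<^sup>2)) (at s)" for s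
        by (rule DERIV_cong[OF DERIV_chain'[of "\<lambda>s. m * s", OF _ DERIV_arctan]])
          (auto intro!: derivative_eq_intros simp: divide_inverse)
      moreover have "continuous_on UNIV (\<lambda>s. m / (1 + (m * s)\<^sup>2))"
        by (intro continuous_intros) (use less_imp_neq[OF add_pos_nonneg[OF zero_less_one zero_le_power2]] in force)
      ultimately have "C1_with (\<lambda>x. arctan (m * u k x)) (\<lambda>i x. D k x * pderiv_at i (u k) x)"
        unfolding D_def by (rule C1_with_compose[OF uC])
      from C1_with_mult[OF \<eta>(1) this]
      have v: "C1_with (\<lambda>x. \<eta> x * arctan (m * u k x))
          (\<lambda>i x. \<eta> x * (D k x * pderiv_at i (u k) x) + \<eta>' i x * arctan (m * u k x))" .
      have v0: "\<eta> x * arctan (m * u k x) = 0" if "x \<notin> K" for x using K(3)[OF that] by simp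
      note W = weak_eigenvalue_equation[OF \<Omega>(1) \<phi>(1,4) K(1,2) v v0, folded g_def f_def]
      have "(\<Sum>i\<in>UNIV. (LINT x|lborel. P i k x) + (LINT x|lborel. Q i k x))
          = (LINT x|lborel. (\<Sum>i\<in>UNIV. P i k x + Q i k x))"
        using P(1) Q(1) by simp
      also have "\<dots> \<le> (LINT x|lborel. (\<Sum>i\<in>UNIV. g i x *
          (\<eta> x * (D k x * pderiv_at i (u k) x) + \<eta>' i x * arctan (m * u k x))))"
      proof (rule integral_mono)
        fix x
        show "(\<Sum>i\<in>UNIV. P i k x + Q i k x) \<le> (\<Sum>i\<in>UNIV. g i x *
          (\<eta> x * (D k x * pderiv_at i (u k) x) + \<eta>' i x * arctan (m * u k x)))"
        proof (rule sum_mono)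
          fix i
          have "0 \<le> (g i x)\<^sup>2 * (\<eta> x * D k x)" using \<eta>(3) D by simp
          then show "P i k x + Q i k x \<le> g i x *
              (\<eta> x * (D k x * pderiv_at i (u k) x) + \<eta>' i x * arctan (m * u k x))"
            by (simp add: P_def Q_def power2_eq_square algebra_simps)
        qed
      qed (use P(1) Q(1) W(1) in auto)
      also have "\<dots> = lam * (LINT x|lborel. R k x)"
        using W(2) by (simp add: R_def)
      finally show ?thesis .
    qed
    have "(\<lambda>k. \<Sum>i\<in>UNIV. (LINT x|lborel. P i k x) + (LINT x|lborel. Q i k x)) \<longlonglongrightarrow>
        (\<Sum>i\<in>UNIV. (LINT x|lborel. g i x * (\<eta>' i x * arctan (m * f x))) + (LINT x|(lborel :: (real^'n) measure). (0::real)))"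
      by (intro tendsto_intros P(2) Q(2))
    from LIMSEQ_le[OF this tendsto_mult_left[OF R, of lam]] key show ?thesis
      by auto
  qed

  \<comment> \<open>The factor is Suc m because \<open>step1\<close> asks for a positive one. Its
    product with f tends to infinity inside \<Omega>, while h vanishes outside.\<close>
  have lim: "(\<lambda>m. LINT x|lborel. h x * (b x * arctan (real (Suc m) * f x))) \<longlonglongrightarrow> (LINT x|lborel. h x * (b x * (pi / 2)))"
    if h: "integrable lborel h" "\<And>x. x \<notin> \<Omega> \<Longrightarrow> h x = 0"
    and b [measurable]: "b \<in> borel_measurable borel" "\<And>x. x \<in> \<Omega> \<Longrightarrow> \<bar>b x\<bar> \<le> c"
    for h b :: "real^'n \<Rightarrow> real" and c
  proof (rule integral_dominated_convergence[where w="\<lambda>x. \<bar>h x\<bar> * (c * 2)"])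
    have [measurable]: "h \<in> borel_measurable borel" using borel_measurable_integrable[OF h(1)] by simp
    show "(\<lambda>x. h x * (b x * (pi / 2))) \<in> borel_measurable lborel"
      "(\<lambda>x. h x * (b x * arctan (real (Suc m) * f x))) \<in> borel_measurable lborel" for m by measurable
    show "integrable lborel (\<lambda>x. \<bar>h x\<bar> * (c * 2))" using h by auto
    show "AE x in lborel. (\<lambda>m. h x * (b x * arctan (real (Suc m) * f x))) \<longlonglongrightarrow> h x * (b x * (pi / 2))"
    proof (rule AE_I2)
      fix x
      show "(\<lambda>m. h x * (b x * arctan (real (Suc m) * f x))) \<longlonglongrightarrow> h x * (b x * (pi / 2))"
      proof (cases "x \<in> \<Omega>")
        case True
        then have "f x > 0" using \<phi>(3)[OF True] by (simp add: f_def)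
        then have "filterlim (\<lambda>m. real (Suc m) * f x) at_top sequentially"
          proof (intro filterlim_at_top_mult_tendsto_pos[OF tendsto_const])
            show "filterlim (\<lambda>m. real (Suc m)) at_top sequentially"
              by (rule filterlim_compose[OF filterlim_real_sequentially filterlim_Suc])
          qed
        from filterlim_compose[OF tendsto_arctan_at_top this] show ?thesis
          by (intro tendsto_mult tendsto_const)
      qed (simp add: h(2))
    qed
    show "AE x in lborel. norm (h x * (b x * arctan (real (Suc m) * f x))) \<le> \<bar>h x\<bar> * (c * 2)" for m
    proof (rule AE_I2)
      fix x
      show "norm (h x * (b x * arctan (real (Suc m) * f x))) \<le> \<bar>h x\<bar> * (c * 2)"
      proof (cases "x \<in> \<Omega>")
        case True
        show ?thesis unfolding real_norm_def abs_mult using b(2)[OF True] at_bd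
          by (intro mult_left_mono mult_mono) auto
      qed (simp add: h(2))
    qed
  qed
  have "(\<Sum>i\<in>UNIV. LINT x|lborel. g i x * (\<eta>' i x * (pi / 2))) \<le> lam * (LINT x|lborel. f x * (\<eta> x * (pi / 2)))"
  proof (rule LIMSEQ_le)
    show "(\<lambda>m. \<Sum>i\<in>UNIV. LINT x|lborel. g i x * (\<eta>' i x * arctan (real (Suc m) * f x)))
        \<longlonglongrightarrow> (\<Sum>i\<in>UNIV. LINT x|lborel. g i x * (\<eta>' i x * (pi / 2)))"
      by (intro tendsto_sum lim[OF g1 g0 _ B1(2)]) auto
    show "(\<lambda>m. lam * (LINT x|lborel. f x * (\<eta> x * arctan (real (Suc m) * f x))))
        \<longlonglongrightarrow> lam * (LINT x|lborel. f x * (\<eta> x * (pi / 2)))"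
      by (intro tendsto_mult tendsto_const lim[OF f1 f0 _ B(2)]) auto
  qed (use step1 in auto)
  then have "pi / 2 * (\<Sum>i\<in>UNIV. LINT x|lborel. g i x * \<eta>' i x) \<le> pi / 2 * (lam * (LINT x|lborel. f x * \<eta> x))"
    by (simp add: mult.assoc[symmetric] sum_distrib_right[symmetric] mult.commute[of pi] sum_divide_distrib[symmetric])
  then have step2: "(\<Sum>i\<in>UNIV. LINT x|lborel. g i x * \<eta>' i x) \<le> lam * (LINT x|lborel. f x * \<eta> x)"
    by simp

  have f\<eta>: "integrable lborel (\<lambda>x. f x * \<eta>'' i i x)" for i
    by (rule bm[OF f1 f0 _ B2(2)]) auto
  have g\<eta>: "integrable lborel (\<lambda>x. g i x * \<eta>' i x)" for i
    by (rule bm[OF g1 g0 _ B1(2)]) auto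
  \<comment> \<open>Here the zero boundary values of \<phi> enter: the identity holds for
    \<open>u k\<close>, which has compact support in \<Omega>, and survives the L2 limit. The
    indicator of \<Omega>, square-integrable because \<Omega> is bounded, serves as the fixed
    function h of \<open>L2_tendsto_integral\<close>.\<close>
  have step3: "(LINT x|lborel. f x * \<eta>'' i i x) + (LINT x|lborel. g i x * \<eta>' i x) = 0" for i
  proof -
    have b1: "\<bar>u k x * \<eta>'' i i x - f x * \<eta>'' i i x\<bar> \<le> B2 i * (\<bar>indicator \<Omega> x\<bar> * \<bar>u k x - f x\<bar>)" for k x
      using mult_right_mono[OF B2(2), of x "\<bar>u k x - f x\<bar>" i] f0[of x] u0[of x k]
      by (cases "x \<in> \<Omega>") (auto simp: left_diff_distrib[symmetric] abs_mult mult.commute)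
    have b2: "\<bar>indicator \<Omega> x * (pderiv_at i (u k) x * \<eta>' i x) - g i x * \<eta>' i x\<bar>
        \<le> B1 i * (\<bar>indicator \<Omega> x\<bar> * \<bar>pderiv_at i (u k) x - g i x\<bar>)" for k x
      using mult_right_mono[OF B1(2), of x "\<bar>pderiv_at i (u k) x - g i x\<bar>" i] g0[of x i]
      by (cases "x \<in> \<Omega>") (auto simp: right_diff_distrib[symmetric] abs_mult mult.commute)
    have c1: "integrable lborel (\<lambda>x. u k x * \<eta>'' i i x)"
      "(\<lambda>k. LINT x|lborel. u k x * \<eta>'' i i x) \<longlonglongrightarrow> (LINT x|lborel. f x * \<eta>'' i i x)" for k
      by (rule L2_tendsto_integral[OF _ _ _ ind u(2,3) f\<eta> b1]; measurable)+
    have c2: "integrable lborel (\<lambda>x. indicator \<Omega> x * (pderiv_at i (u k) x * \<eta>' i x))"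
      "(\<lambda>k. LINT x|lborel. indicator \<Omega> x * (pderiv_at i (u k) x * \<eta>' i x)) \<longlonglongrightarrow> (LINT x|lborel. g i x * \<eta>' i x)" for k
      by (rule L2_tendsto_integral[OF _ _ _ ind u(4,5) g\<eta> b2]; measurable)+
    have z: "(LINT x|lborel. u k x * \<eta>'' i i x) + (LINT x|lborel. indicator \<Omega> x * (pderiv_at i (u k) x * \<eta>' i x)) = 0" for k
    proof -
      obtain K where K: "compact K" "K \<subseteq> \<Omega>" "\<And>x. x \<notin> K \<Longrightarrow> u k x = 0" "\<And>i x. x \<notin> K \<Longrightarrow> pderiv_at i (u k) x = 0"
        using test_fun_C1_with[OF u(1)[of k]] by metis
      have z: "(LINT x|lborel. u k x * \<eta>'' i i x + pderiv_at i (u k) x * \<eta>' i x) = 0"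
        by (rule integral_partial_derivative_eq_0(2)[OF C1_with_mult[OF uC \<eta>(2)] K(1)]) (auto simp: K)
      have e: "pderiv_at i (u k) x * \<eta>' i x = indicator \<Omega> x * (pderiv_at i (u k) x * \<eta>' i x)" for x
        using K by (auto split: split_indicator)
      have "(LINT x|lborel. u k x * \<eta>'' i i x + indicator \<Omega> x * (pderiv_at i (u k) x * \<eta>' i x)) = 0"
        unfolding e[symmetric] by (rule z)
      then show ?thesis using c1(1) c2(1) by simp
    qed
    show ?thesis
      using tendsto_add[OF c1(2) c2(2)] unfolding z by (metis LIMSEQ_const_iff)
  qed
  have "- lam * (LINT x|lborel. f x * \<eta> x) \<le> (\<Sum>i\<in>UNIV. - (LINT x|lborel. g i x * \<eta>' i x))"
    using step2 by (simp add: sum_negf)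
  also have "\<dots> = (\<Sum>i\<in>UNIV. LINT x|lborel. f x * \<eta>'' i i x)"
  proof (rule sum.cong)
    show "- (LINT x|lborel. g i x * \<eta>' i x) = (LINT x|lborel. f x * \<eta>'' i i x)" for i
      using step3[of i] by linarith
  qed simp
  also have "\<dots> = (LINT x|lborel. f x * (\<Sum>i\<in>UNIV. \<eta>'' i i x))"
    using f\<eta> by (simp add: sum_distrib_left)
  finally show "- lam * (LINT x|lborel. indicator \<Omega> x * \<phi> x * \<eta> x)
      \<le> (LINT x|lborel. indicator \<Omega> x * \<phi> x * (\<Sum>i\<in>UNIV. \<eta>'' i i x))"
    by (simp add: f_def)
qed

section \<open>The heat kernel\<close>

text \<open>The factor \<open>(4 \<pi>)\<close> to the power \<open>- n / 2\<close> is left out, so the total mass is a positive constant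
  whose value is never needed.\<close>

definition heat :: "real \<Rightarrow> real^'n \<Rightarrow> real" where
  "heat t z = t powr (- real CARD('n) / 2) * exp (- (norm z)\<^sup>2 / (4 * t))"

lemma heat_pos: "t > 0 \<Longrightarrow> heat t z > 0"
  by (simp add: heat_def)

lemma heat_le: "t > 0 \<Longrightarrow> heat t (z :: real^'n) \<le> t powr (- real CARD('n) / 2)"
  by (simp add: heat_def mult_le_cancel_left1)

lemma continuous_on_heat: "continuous_on UNIV (heat t)"
  unfolding heat_def by (cases "t = 0") (auto intro!: continuous_intros)

lemma borel_measurable_heat [measurable]: "heat t \<in> borel_measurable borel"
  by (rule borel_measurable_continuous_onI[OF continuous_on_heat])

lemma C1_with_norm_diff_sq: "C1_with (\<lambda>y::real^'n. (norm (y - x))\<^sup>2) (\<lambda>i y. 2 * (y - x) $ i)"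
  unfolding C1_with_def
proof (intro conjI allI)
  fix y
  have "((\<lambda>y. (y - x) \<bullet> (y - x)) has_derivative (\<lambda>v. (y - x) \<bullet> v + v \<bullet> (y - x))) (at y)"
    by (rule has_derivative_inner) (auto intro!: derivative_eq_intros)
  then show "((\<lambda>y. (norm (y - x))\<^sup>2) has_derivative (\<lambda>v. \<Sum>i\<in>UNIV. v $ i * (2 * (y - x) $ i))) (at y)"
    unfolding power2_norm_eq_inner by (rule has_derivative_eq_rhs)
      (simp add: fun_eq_iff inner_vec_def sum.distrib[symmetric] algebra_simps)
qed (auto intro!: continuous_intros)

lemma C1_with_component: "C1_with (\<lambda>y::real^'n. c * (y - x) $ i) (\<lambda>j y. if j = i then c else 0)"
  unfolding C1_with_def
proof (intro conjI allI)
  fix y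
  have "((\<lambda>y. c * (y - x) $ i) has_derivative (\<lambda>v. c * v $ i)) (at y)"
    by (auto intro!: derivative_eq_intros bounded_linear.has_derivative[OF bounded_linear_vec_nth])
  then show "((\<lambda>y. c * (y - x) $ i) has_derivative (\<lambda>v. \<Sum>j\<in>UNIV. v $ j * (if j = i then c else 0))) (at y)"
    by (simp add: if_distrib cong: if_cong) (simp add: mult.commute)
qed auto

text \<open>Differentiating through the squared norm avoids the singularity of the norm at the
  centre. The two parts have the shape that \<open>weak_subsolution\<close> requires of \<eta>,
  \<eta>' and \<eta>''.\<close>

lemma C1_with_heat:
  fixes x :: "real^'n"
  assumes "t > 0"
  shows "C1_with (\<lambda>y. heat t (y - x)) (\<lambda>i y. - 1 / (2 * t) * (y - x) $ i * heat t (y - x))"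
    "C1_with (\<lambda>y. - 1 / (2 * t) * (y - x) $ i * heat t (y - x))
       (\<lambda>j y. - 1 / (2 * t) * (y - x) $ i * (- 1 / (2 * t) * (y - x) $ j * heat t (y - x))
          + (if j = i then - 1 / (2 * t) else 0) * heat t (y - x))"
proof -
  let ?h = "\<lambda>s. t powr (- real CARD('n) / 2) * exp (- s / (4 * t))"
  have "(?h has_real_derivative - 1 / (4 * t) * ?h s) (at s)" for s
    using assms by (auto intro!: derivative_eq_intros)
  moreover have "continuous_on UNIV (\<lambda>s. - 1 / (4 * t) * ?h s)"
    using assms by (auto intro!: continuous_intros)
  ultimately have "C1_with (\<lambda>y. ?h ((norm (y - x))\<^sup>2))
      (\<lambda>i y. - 1 / (4 * t) * ?h ((norm (y - x))\<^sup>2) * (2 * (y - x) $ i))"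
    by (rule C1_with_compose[OF C1_with_norm_diff_sq])
  moreover have "(\<lambda>i y. - 1 / (4 * t) * ?h ((norm (y - x))\<^sup>2) * (2 * (y - x) $ i))
      = (\<lambda>i y. - 1 / (2 * t) * (y - x) $ i * heat t (y - x))"
  proof -
    have "- 1 / (4 * t) * H * (2 * c) = - 1 / (2 * t) * c * H" for c H :: real
      by (simp add: field_simps)
    then show ?thesis unfolding heat_def by (intro ext)
  qed
  ultimately show 1: "C1_with (\<lambda>y. heat t (y - x)) (\<lambda>i y. - 1 / (2 * t) * (y - x) $ i * heat t (y - x))"
    by (simp add: heat_def)
  show "C1_with (\<lambda>y. - 1 / (2 * t) * (y - x) $ i * heat t (y - x))
       (\<lambda>j y. - 1 / (2 * t) * (y - x) $ i * (- 1 / (2 * t) * (y - x) $ j * heat t (y - x))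
          + (if j = i then - 1 / (2 * t) else 0) * heat t (y - x))"
    by (rule C1_with_mult[OF C1_with_component 1])
qed

text \<open>The common value of the Laplacian in z (\<open>laplacian_heat\<close>) and of the time
  derivative (\<open>heat_has_time_derivative\<close>); the two lemmas together are the heat
  equation.\<close>

definition heat_deriv :: "real \<Rightarrow> real^'n \<Rightarrow> real" where
  "heat_deriv t z = ((norm z)\<^sup>2 / (4 * t\<^sup>2) - real CARD('n) / (2 * t)) * heat t z"

text \<open>The trivial test i = i is kept so that the left side is literally the diagonal of the
  second derivatives in \<open>C1_with_heat\<close> and can be rewritten by unfolding.\<close>

lemma laplacian_heat:
  fixes z :: "real^'n"
  assumes "t > 0"
  shows "(\<Sum>i\<in>UNIV. - 1 / (2 * t) * z $ i * (- 1 / (2 * t) * z $ i * heat t z)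
          + (if i = i then - 1 / (2 * t) else 0) * heat t z) = heat_deriv t z"
proof -
  have "(\<Sum>i\<in>UNIV. - 1 / (2 * t) * z $ i * (- 1 / (2 * t) * z $ i * heat t z)
          + (if i = i then - 1 / (2 * t) else 0) * heat t z)
     = (\<Sum>i\<in>UNIV. heat t z / (4 * t\<^sup>2) * (z $ i)\<^sup>2 - heat t z / (2 * t))"
    using assms by (intro sum.cong refl) (simp add: field_simps power2_eq_square)
  also have "\<dots> = heat t z / (4 * t\<^sup>2) * (norm z)\<^sup>2 - real CARD('n) * (heat t z / (2 * t))"
    by (simp add: sum_subtractf sum_distrib_left[symmetric] sum_divide_distrib[symmetric] power2_norm_eq_inner inner_vec_def power2_eq_square[symmetric])
  also have "\<dots> = heat_deriv t z" by (simp add: heat_deriv_def algebra_simps)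
  finally show ?thesis .
qed

lemma heat_has_time_derivative:
  assumes "t > 0"
  shows "((\<lambda>t. heat t (z :: real^'n)) has_real_derivative heat_deriv t z) (at t)"
proof -
  let ?a = "- real CARD('n) / 2"
  have "((\<lambda>t. t powr ?a) has_real_derivative ?a * t powr (?a - 1)) (at t)"
    using assms by (intro has_real_derivative_powr) auto
  moreover have "((\<lambda>t. exp (- (norm z)\<^sup>2 / (4 * t))) has_real_derivative
      exp (- (norm z)\<^sup>2 / (4 * t)) * ((norm z)\<^sup>2 / (4 * t\<^sup>2))) (at t)"
    using assms by (auto intro!: derivative_eq_intros simp: field_simps power2_eq_square)
  ultimately have "((\<lambda>t. heat t z) has_real_derivative
      t powr ?a * (exp (- (norm z)\<^sup>2 / (4 * t)) * ((norm z)\<^sup>2 / (4 * t\<^sup>2)))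
      + ?a * t powr (?a - 1) * exp (- (norm z)\<^sup>2 / (4 * t))) (at t)"
    unfolding heat_def by (rule DERIV_mult')
  moreover have "t powr (?a - 1) = t powr ?a / t"
    using assms by (simp add: powr_diff)
  ultimately show ?thesis
    using assms by (simp add: heat_deriv_def heat_def algebra_simps)
qed

text \<open>The Gaussian is a product over the coordinates, and each factor exp (- x^2 / 4) is the
  normal density of variance 2 up to its normalisation.\<close>

lemma integrable_heat_1: "integrable lborel (heat 1 :: real^'n \<Rightarrow> real)"
proof -
  interpret product_sigma_finite "\<lambda>_ :: real^'n. lborel :: real measure"
    by standard
  have 1: "integrable lborel (\<lambda>x::real. exp (- x\<^sup>2 / 4))"
  proof -
    have "integrable lborel (\<lambda>x. sqrt (2 * pi * 2) * normal_density 0 (sqrt 2) x)"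
      by auto
    then show ?thesis by (simp add: normal_density_def)
  qed
  have "integrable (\<Pi>\<^sub>M b\<in>(Basis :: (real^'n) set). lborel) (\<lambda>f. \<Prod>b\<in>Basis. exp (- (f b)\<^sup>2 / 4 :: real))"
    by (rule product_integrable_prod) (use 1 in auto)
  moreover have "heat 1 (\<Sum>b\<in>Basis. f b *\<^sub>R b) = (\<Prod>b\<in>(Basis :: (real^'n) set). exp (- (f b)\<^sup>2 / 4))" for f
  proof -
    have "(norm (\<Sum>b\<in>(Basis :: (real^'n) set). f b *\<^sub>R b))\<^sup>2 = (\<Sum>b\<in>(Basis :: (real^'n) set). (f b)\<^sup>2)"
      unfolding power2_norm_eq_inner by (subst euclidean_inner) (simp add: power2_eq_square)
    then show ?thesis
      by (simp add: heat_def exp_sum[symmetric] sum_divide_distrib sum_negf)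
  qed
  ultimately show ?thesis
    by (subst lborel_eq) (simp add: integrable_distr_eq)
qed

section \<open>Scaling and total mass of the kernel\<close>

lemma lborel_integral_affine:
  fixes f :: "'a::euclidean_space \<Rightarrow> real"
  assumes [measurable]: "f \<in> borel_measurable borel" and "c > 0"
  shows "(LINT x|lborel. f x) = c ^ DIM('a) * (LINT z|lborel. f (x + c *\<^sub>R z))"
proof -
  have "(LINT x|lborel. f x) = (LINT x|density (distr lborel borel (\<lambda>z. x + c *\<^sub>R z)) (\<lambda>_. \<bar>c\<bar>^DIM('a)). f x)"
    using assms by (subst lborel_affine[of c x]) auto
  also have "\<dots> = (LINT x|distr lborel borel (\<lambda>z. x + c *\<^sub>R z). \<bar>c\<bar>^DIM('a) *\<^sub>R f x)"
    by (subst integral_density) auto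
  also have "\<dots> = (LINT z|lborel. \<bar>c\<bar>^DIM('a) *\<^sub>R f (x + c *\<^sub>R z))"
    by (subst integral_distr) auto
  finally show ?thesis using assms by simp
qed

text \<open>The substitution y = x + sqrt t z, whose Jacobian cancels the power of t in
  \<open>heat\<close>. With h = 1 it shows that the mass is constant in time; for general h it moves
  t out of the kernel, which prepares the limit t -> 0.\<close>

lemma integral_heat_scaling:
  fixes h :: "real^'n \<Rightarrow> real"
  assumes [measurable]: "h \<in> borel_measurable borel" and t: "t > 0"
  shows "(LINT y|lborel. h y * heat t (y - x)) = (LINT z|lborel. h (x + sqrt t *\<^sub>R z) * heat 1 z)"
proof -
  have n: "sqrt t ^ CARD('n) * t powr (- real CARD('n) / 2) = 1"
  proof -
    have "sqrt t ^ CARD('n) = t powr (real CARD('n) / 2)"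
      using t by (simp add: powr_half_sqrt[symmetric] powr_realpow[symmetric] powr_powr)
    then show ?thesis using t by (simp add: powr_add[symmetric])
  qed
  have heat: "sqrt t ^ CARD('n) * heat t (sqrt t *\<^sub>R z) = heat 1 z" for z :: "real^'n"
    unfolding heat_def mult.assoc[symmetric] n using t by (simp add: power_mult_distrib)
  have "(LINT y|lborel. h y * heat t (y - x))
      = sqrt t ^ CARD('n) * (LINT z|lborel. h (x + sqrt t *\<^sub>R z) * heat t (sqrt t *\<^sub>R z))"
    using t by (subst lborel_integral_affine[of _ "sqrt t" x]) auto
  also have "\<dots> = (LINT z|lborel. h (x + sqrt t *\<^sub>R z) * (sqrt t ^ CARD('n) * heat t (sqrt t *\<^sub>R z)))"
    by (subst integral_mult_right_zero[symmetric]) (simp add: mult_ac)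
  finally show ?thesis by (simp add: heat)
qed

definition heat_mass :: "'n::finite itself \<Rightarrow> real" where
  "heat_mass _ = (LINT z|lborel. heat 1 (z :: real^'n))"

lemma heat_mass_pos: "heat_mass TYPE('n::finite) > 0"
proof -
  have "heat_mass TYPE('n) \<noteq> 0"
  proof
    assume "heat_mass TYPE('n) = 0"
    then have "AE z in lborel. heat 1 (z :: real^'n) = 0"
      unfolding heat_mass_def
      by (subst (asm) integral_nonneg_eq_0_iff_AE[OF integrable_heat_1])
         (auto intro!: AE_I2 less_imp_le heat_pos)
    moreover have "heat 1 z \<noteq> 0" for z :: "real^'n" using heat_pos[of 1 z] by simp
    ultimately have "AE z in (lborel :: (real^'n) measure). False" by simp
    then show False by (simp add: eventually_False ae_filter_eq_bot_iff)
  qed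
  moreover have "heat_mass TYPE('n) \<ge> 0"
    unfolding heat_mass_def by (intro Bochner_Integration.integral_nonneg) (simp add: less_imp_le heat_pos)
  ultimately show ?thesis by simp
qed

lemma heat_mass_eq:
  assumes "t > 0"
  shows "(LINT y|lborel. heat t (y - (x :: real^'n))) = heat_mass TYPE('n)"
  using integral_heat_scaling[OF _ assms, of "\<lambda>_. 1" x] by (simp add: heat_mass_def)

text \<open>A non-integrable function has Bochner integral 0 by default, whereas this integral is
  the positive mass.\<close>

lemma integrable_heat:
  assumes "t > 0"
  shows "integrable lborel (\<lambda>y. heat t (y - (x :: real^'n)))"
  using heat_mass_eq[OF assms, of x] heat_mass_pos[where 'n='n] not_integrable_integral_eq by force

section \<open>The mean value inequality for ground states\<close>

text \<open>The eigenvalue is a real number here, which keeps extended-real arithmetic out of the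
  analysis; \<open>ground_state_eigenvalue\<close> makes the connection with
  \<open>lambda1\<close>.\<close>

locale positive_eigenfunction =
  fixes \<Omega> :: "(real^'n) set" and \<phi> :: "real^'n \<Rightarrow> real" and lam :: real
  assumes open_dom: "open \<Omega>" and bounded_dom: "bounded \<Omega>"
    and smooth: "smooth_on \<Omega> \<phi>" and H10: "in_H10 \<Omega> \<phi>"
    and pos: "\<And>x. x \<in> \<Omega> \<Longrightarrow> \<phi> x > 0"
    and eigen: "\<And>x. x \<in> \<Omega> \<Longrightarrow> - laplacian \<phi> x = lam * \<phi> x"
begin

definition zero_ext :: "real^'n \<Rightarrow> real" where
  "zero_ext x = indicator \<Omega> x * \<phi> x"

lemma zero_ext_nonneg: "zero_ext x \<ge> 0"
  using pos[of x] by (auto simp: zero_ext_def split: split_indicator)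

lemma zero_ext_eq: "x \<in> \<Omega> \<Longrightarrow> zero_ext x = \<phi> x" "x \<notin> \<Omega> \<Longrightarrow> zero_ext x = 0"
  by (auto simp: zero_ext_def)

lemma borel_measurable_zero_ext [measurable]: "zero_ext \<in> borel_measurable borel"
  unfolding zero_ext_def[abs_def] using borel_measurable_indicator_smooth[OF open_dom smooth] .

lemma integrable_zero_ext: "integrable lborel zero_ext"
proof -
  \<comment> \<open>Integrability is the part of \<open>weak_subsolution\<close> that does not
    mention \<eta>, so \<eta> = 0 will do.\<close>
  have "C1_with (\<lambda>_::real^'n. 0) (\<lambda>_ _. 0)"
    by (simp add: C1_with_def)
  from weak_subsolution(1)[OF open_dom bounded_dom smooth H10 pos eigen this this]
  show ?thesis by (simp add: zero_ext_def[abs_def])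
qed

text \<open>Up to the constant omitted from the kernel, the solution at time t of the heat equation
  on the whole space with initial datum \<open>zero_ext\<close>.\<close>

definition heat_avg :: "real^'n \<Rightarrow> real \<Rightarrow> real" where
  "heat_avg x t = (LINT y|lborel. zero_ext y * heat t (y - x))"

lemma integrable_zero_ext_heat:
  assumes "t > 0"
  shows "integrable lborel (\<lambda>y. zero_ext y * heat t (y - x))"
proof (rule Bochner_Integration.integrable_bound)
  show "integrable lborel (\<lambda>y. zero_ext y * t powr (- real CARD('n) / 2))"
    using integrable_zero_ext by simp
  show "AE y in lborel. norm (zero_ext y * heat t (y - x)) \<le> norm (zero_ext y * t powr (- real CARD('n) / 2))"
    by (intro AE_I2) (auto simp: abs_mult abs_of_pos[OF heat_pos[OF assms]] intro!: mult_left_mono heat_le[OF assms, simplified])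
qed simp

lemma heat_avg_le:
  assumes "t > 0"
  shows "heat_avg x t \<le> t powr (- real CARD('n) / 2) * (LINT y|lborel. zero_ext y)"
proof -
  have "heat_avg x t \<le> (LINT y|lborel. zero_ext y * t powr (- real CARD('n) / 2))"
    unfolding heat_avg_def using integrable_zero_ext integrable_zero_ext_heat[OF assms] heat_le[OF assms] zero_ext_nonneg
    by (intro integral_mono) (auto intro!: mult_left_mono)
  then show ?thesis by (simp add: mult.commute)
qed

lemma heat_avg_has_derivative:
  assumes t: "t > 0"
  shows "(heat_avg x has_real_derivative (LINT y|lborel. zero_ext y * heat_deriv t (y - x))) (at t)"
proof -
  obtain R where R: "\<And>y. y \<in> \<Omega> \<Longrightarrow> norm y \<le> R"
    using bounded_dom by (auto simp: bounded_iff)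
  \<comment> \<open>The window from t / 2 to 2 t keeps s away from 0, where the kernel is singular;
    C bounds the time derivative for all s > a and all y in the bounded set \<Omega>.\<close>
  define a where "a = t / 2"
  have a: "a > 0" using t by (simp add: a_def)
  define C where "C = ((R + norm x)\<^sup>2 / (4 * a\<^sup>2) + real CARD('n) / (2 * a)) * a powr (- real CARD('n) / 2)"
  have bd: "\<bar>heat_deriv s (y - x)\<bar> \<le> C" if "s > a" "y \<in> \<Omega>" for s y
  proof -
    have s: "s > 0" using that a by simp
    have n: "norm (y - x) \<le> R + norm x"
      using R[OF that(2)] norm_triangle_ineq4[of y x] by simp
    have h: "heat s (y - x) \<le> a powr (- real CARD('n) / 2)"
      using heat_le[OF s, of "y - x"] powr_mono2'[of "- real CARD('n) / 2" a s] that a by simp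
    have q: "(norm (y - x))\<^sup>2 / (4 * s\<^sup>2) \<le> (R + norm x)\<^sup>2 / (4 * a\<^sup>2)"
      using n a that by (intro frac_le mult_left_mono power_mono) auto
    have r: "real CARD('n) / (2 * s) \<le> real CARD('n) / (2 * a)"
      using a that by (intro frac_le) auto
    have "\<bar>(norm (y - x))\<^sup>2 / (4 * s\<^sup>2) - real CARD('n) / (2 * s)\<bar>
        \<le> (norm (y - x))\<^sup>2 / (4 * s\<^sup>2) + real CARD('n) / (2 * s)"
      using s by (intro abs_leI) auto
    also have "\<dots> \<le> (R + norm x)\<^sup>2 / (4 * a\<^sup>2) + real CARD('n) / (2 * a)"
      using q r by simp
    finally show ?thesis
      unfolding heat_deriv_def C_def abs_mult using h heat_pos[OF s, of "y - x"] by (intro mult_mono) auto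
  qed
  have "((\<lambda>s. LINT y|lborel. zero_ext y * heat s (y - x)) has_real_derivative
      (LINT y|lborel. zero_ext y * heat_deriv t (y - x))) (at t)"
  proof (rule integral_has_real_derivative_dominated[where a=a and b="2 * t" and w="\<lambda>y. zero_ext y * C"
        and f'="\<lambda>s y. zero_ext y * heat_deriv s (y - x)"])
    show "integrable lborel (\<lambda>y. zero_ext y * C)" using integrable_zero_ext by simp
    show "(\<lambda>y. zero_ext y * heat_deriv t (y - x)) \<in> borel_measurable lborel"
      unfolding heat_deriv_def by measurable
    fix s y assume s: "a < s" "s < 2 * t"
    show "integrable lborel (\<lambda>y. zero_ext y * heat s (y - x))"
      using a s by (intro integrable_zero_ext_heat) auto
    show "((\<lambda>s. zero_ext y * heat s (y - x)) has_real_derivative zero_ext y * heat_deriv s (y - x)) (at s)"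
      using a s by (intro DERIV_cmult heat_has_time_derivative) auto
    show "\<bar>zero_ext y * heat_deriv s (y - x)\<bar> \<le> zero_ext y * C"
      using bd[OF s(1), of y] zero_ext_nonneg[of y] zero_ext_eq(2)[of y]
      by (cases "y \<in> \<Omega>") (auto simp: abs_mult intro!: mult_left_mono)
  qed (use a t in \<open>auto simp: a_def\<close>)
  then show ?thesis by (simp add: heat_avg_def[abs_def])
qed

text \<open>The heat kernel centred at x is taken as \<eta> in
  \<open>weak_subsolution\<close>.\<close>

lemma heat_avg_differential_inequality:
  assumes "t > 0"
  shows "- lam * heat_avg x t \<le> (LINT y|lborel. zero_ext y * heat_deriv t (y - x))"
  using weak_subsolution(2)[OF open_dom bounded_dom smooth H10 pos eigen C1_with_heat[OF assms, of x]
      less_imp_le[OF heat_pos[OF assms]]]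
  unfolding laplacian_heat[OF assms] by (simp add: heat_avg_def zero_ext_def)

lemma heat_avg_mono:
  assumes "0 < s" "s \<le> t"
  shows "exp (lam * s) * heat_avg x s \<le> exp (lam * t) * heat_avg x t"
proof (rule DERIV_nonneg_imp_nondecreasing[OF assms(2)])
  fix r assume "s \<le> r" "r \<le> t"
  then have r: "r > 0" using assms by simp
  define D where "D = (LINT y|lborel. zero_ext y * heat_deriv r (y - x))"
  have "((\<lambda>r. exp (lam * r) * heat_avg x r) has_real_derivative
      exp (lam * r) * D + (exp (lam * r) * lam) * heat_avg x r) (at r)"
    unfolding D_def
    by (rule DERIV_mult'[OF _ heat_avg_has_derivative[OF r]]) (auto intro!: derivative_eq_intros)
  moreover have "exp (lam * r) * (D + lam * heat_avg x r) \<ge> 0"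
    using heat_avg_differential_inequality[OF r, of x] by (simp add: D_def)
  ultimately show "\<exists>y. ((\<lambda>r. exp (lam * r) * heat_avg x r) has_real_derivative y) (at r) \<and> 0 \<le> y"
    by (intro exI conjI) (auto simp: algebra_simps)
qed

text \<open>By \<open>heat_avg_mono\<close> the right side dominates its own values at times s k ->
  0. Only a lower bound for the averages at those times is needed, so cutting
  \<open>zero_ext\<close> off from above does no harm, and continuity of \<phi> at x identifies the
  limit.\<close>

lemma heat_mean_value_inequality:
  assumes x: "x \<in> \<Omega>" and t: "t > 0"
  shows "heat_mass TYPE('n) * \<phi> x \<le> exp (lam * t) * heat_avg x t"
proof -
  define s where "s k = t / real (Suc k)" for k
  have s: "0 < s k" "s k \<le> t" for k
    using t by (auto simp: s_def divide_le_eq mult_le_cancel_left1)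
  have s0: "s \<longlonglongrightarrow> 0"
    unfolding s_def by (rule tendsto_divide_0[OF tendsto_const])
      (intro filterlim_at_top_imp_at_infinity filterlim_compose[OF filterlim_real_sequentially filterlim_Suc])
  \<comment> \<open>truncation provides the dominating function for the limit of vanishing time\<close>
  define h where "h y = min (zero_ext y) (\<phi> x)" for y
  have [measurable]: "h \<in> borel_measurable borel" unfolding h_def by measurable
  have h0: "0 \<le> h y" "h y \<le> \<phi> x" "h y \<le> zero_ext y" for y
    using zero_ext_nonneg[of y] pos[OF x] by (auto simp: h_def)
  have "isCont zero_ext x"
  proof -
    have "isCont \<phi> x" using smooth_onD(1)[OF smooth] open_dom x by (simp add: continuous_on_eq_continuous_at)
    moreover have "eventually (\<lambda>y. zero_ext y = \<phi> y) (nhds x)"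
      using eventually_nhds_in_open[OF open_dom x] by (rule eventually_mono) (simp add: zero_ext_eq)
    ultimately show ?thesis by (simp add: isCont_cong)
  qed
  then have hcont: "isCont h x" unfolding h_def by (intro continuous_intros)
  have hx: "h x = \<phi> x" using x by (simp add: h_def zero_ext_eq)
  have lower: "(LINT z|lborel. h (x + sqrt (s k) *\<^sub>R z) * heat 1 z) \<le> heat_avg x (s k)" for k
  proof -
    have "(LINT z|lborel. h (x + sqrt (s k) *\<^sub>R z) * heat 1 z) = (LINT y|lborel. h y * heat (s k) (y - x))"
      by (rule integral_heat_scaling[symmetric]) (use s in auto)
    also have "\<dots> \<le> heat_avg x (s k)"
      unfolding heat_avg_def
    proof (rule integral_mono[OF _ integrable_zero_ext_heat[OF s(1)]])
      show le: "h y * heat (s k) (y - x) \<le> zero_ext y * heat (s k) (y - x)" for y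
        using h0 by (intro mult_right_mono less_imp_le[OF heat_pos[OF s(1)]])
      show "integrable lborel (\<lambda>y. h y * heat (s k) (y - x))"
      proof (rule Bochner_Integration.integrable_bound[OF integrable_zero_ext_heat[OF s(1), of k x]])
        show "AE y in lborel. norm (h y * heat (s k) (y - x)) \<le> norm (zero_ext y * heat (s k) (y - x))"
          using h0 zero_ext_nonneg
          by (intro AE_I2) (auto simp: abs_mult less_imp_le[OF heat_pos[OF s(1)]] intro!: mult_right_mono)
      qed simp
    qed
    finally show ?thesis .
  qed
  have "(\<lambda>k. LINT z|lborel. h (x + sqrt (s k) *\<^sub>R z) * heat 1 z) \<longlonglongrightarrow> (LINT z|lborel. \<phi> x * heat 1 (z::real^'n))"
  proof (rule integral_dominated_convergence[where w="\<lambda>z. \<phi> x * heat 1 (z::real^'n)"])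
    show "integrable lborel (\<lambda>z. \<phi> x * heat 1 (z::real^'n))" by (simp add: integrable_heat_1)
    show "AE z in lborel. (\<lambda>k. h (x + sqrt (s k) *\<^sub>R z) * heat 1 z) \<longlonglongrightarrow> \<phi> x * heat 1 z"
    proof (rule AE_I2)
      fix z
      have "(\<lambda>k. x + sqrt (s k) *\<^sub>R z) \<longlonglongrightarrow> x + sqrt 0 *\<^sub>R z"
        by (intro tendsto_intros s0)
      then have "(\<lambda>k. h (x + sqrt (s k) *\<^sub>R z)) \<longlonglongrightarrow> h x"
        by (intro isCont_tendsto_compose[OF hcont]) simp
      then show "(\<lambda>k. h (x + sqrt (s k) *\<^sub>R z) * heat 1 z) \<longlonglongrightarrow> \<phi> x * heat 1 z"
        unfolding hx by (intro tendsto_intros)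
    qed
    show "AE z in lborel. norm (h (x + sqrt (s k) *\<^sub>R z) * heat 1 z) \<le> \<phi> x * heat 1 z" for k
      using h0 by (intro AE_I2) (auto simp: abs_mult abs_of_pos[OF heat_pos] less_imp_le[OF heat_pos] intro!: mult_right_mono)
  qed auto
  then have "(\<lambda>k. exp (lam * s k) * (LINT z|lborel. h (x + sqrt (s k) *\<^sub>R z) * heat 1 z))
      \<longlonglongrightarrow> exp (lam * 0) * (LINT z|lborel. \<phi> x * heat 1 (z::real^'n))"
    by (intro tendsto_intros s0)
  then have "exp (lam * 0) * (LINT z|lborel. \<phi> x * heat 1 (z::real^'n)) \<le> exp (lam * t) * heat_avg x t"
  proof (rule LIMSEQ_le_const2, intro exI allI impI)
    fix k
    have "exp (lam * s k) * (LINT z|lborel. h (x + sqrt (s k) *\<^sub>R z) * heat 1 z)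
        \<le> exp (lam * s k) * heat_avg x (s k)"
      using lower by (intro mult_left_mono) auto
    also have "\<dots> \<le> exp (lam * t) * heat_avg x t" by (rule heat_avg_mono[OF s])
    finally show "exp (lam * s k) * (LINT z|lborel. h (x + sqrt (s k) *\<^sub>R z) * heat 1 z)
        \<le> exp (lam * t) * heat_avg x t" .
  qed
  then show ?thesis by (simp add: heat_mass_def mult.commute)
qed

lemma bounded_above: "\<exists>B. \<forall>x\<in>\<Omega>. \<phi> x \<le> B"
proof (intro exI ballI)
  fix x assume "x \<in> \<Omega>"
  have "heat_mass TYPE('n) * \<phi> x \<le> exp lam * heat_avg x 1"
    using heat_mean_value_inequality[OF \<open>x \<in> \<Omega>\<close>, of 1] by simp
  also have "\<dots> \<le> exp lam * (LINT y|lborel. zero_ext y)"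
    using heat_avg_le[of 1 x] by simp
  finally show "\<phi> x \<le> exp lam * (LINT y|lborel. zero_ext y) / heat_mass TYPE('n)"
    using heat_mass_pos[where 'n='n] by (simp add: pos_le_divide_eq mult.commute)
qed

text \<open>For lam = 0 the exponential factor is 1, while the averages decay like t^(-n/2). A
  positive eigenvalue is what makes the length sqrt (\<kappa> / lam) of the final proof
  meaningful.\<close>

lemma eigenvalue_nonzero:
  assumes "\<Omega> \<noteq> {}"
  shows "lam \<noteq> 0"
proof
  assume lam: "lam = 0"
  obtain x where x: "x \<in> \<Omega>" using assms by auto
  have "((\<lambda>t. t powr (- real CARD('n) / 2) * (LINT y|lborel. zero_ext y)) \<longlongrightarrow> 0 * (LINT y|lborel. zero_ext y)) at_top"
    by (intro tendsto_mult tendsto_const tendsto_neg_powr filterlim_ident) simp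
  moreover have "eventually (\<lambda>t. heat_mass TYPE('n) * \<phi> x \<le> t powr (- real CARD('n) / 2) * (LINT y|lborel. zero_ext y)) at_top"
    using eventually_gt_at_top[of 0]
  proof (rule eventually_mono)
    fix t :: real assume "0 < t"
    then show "heat_mass TYPE('n) * \<phi> x \<le> t powr (- real CARD('n) / 2) * (LINT y|lborel. zero_ext y)"
      using heat_mean_value_inequality[OF x \<open>0 < t\<close>] heat_avg_le[OF \<open>0 < t\<close>, of x] lam by simp
  qed
  ultimately have "heat_mass TYPE('n) * \<phi> x \<le> 0 * (LINT y|lborel. zero_ext y)"
    by (intro tendsto_lowerbound) auto
  moreover have "heat_mass TYPE('n) * \<phi> x > 0" using pos[OF x] heat_mass_pos[where 'n='n] by simp
  ultimately show False by simp
qed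

text \<open>E is the part of the ball around z outside \<Omega>. Its points are within 2 r of y, so
  at time r^2 the kernel is at least r^(-n) exp (-1) on E: the exponent is (2 r)^2 / (4 r^2) = 1.
  Asymmetry gives |E| >= \<alpha> r^n |B_1|, and the powers of r cancel. Since
  \<open>zero_ext\<close> vanishes on E, this mass may be subtracted before bounding by S.\<close>

lemma near_boundary_decay:
  assumes asym: "asymmetric \<alpha> \<Omega>"
    and S: "\<And>x. x \<in> \<Omega> \<Longrightarrow> \<phi> x \<le> S" "S \<ge> 0"
    and y: "y \<in> \<Omega>" and z: "z \<in> frontier \<Omega>" "dist y z < r"
  shows "heat_mass TYPE('n) * \<phi> y
    \<le> exp (lam * r\<^sup>2) * S * (heat_mass TYPE('n) - \<alpha> * measure lborel (ball (0::real^'n) 1) * exp (-1))"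
proof -
  have r: "r > 0" using z(2) zero_le_dist[of y z] by linarith
  have r2: "r\<^sup>2 > 0" using r by simp
  define E where "E = ball z r - \<Omega>"
  have [measurable]: "E \<in> sets borel" "\<Omega> \<in> sets borel" using open_dom by (auto simp: E_def)
  have fin: "emeasure lborel E < \<infinity>"
    using emeasure_bounded_finite[of E] by (auto simp: E_def intro: bounded_subset[OF bounded_ball])
  have vol: "measure lborel (ball c r) = r ^ CARD('n) * measure lborel (ball (0::real^'n) 1)" for c :: "real^'n"
    using content_ball[of r c] content_ball[of 1 "0::real^'n"] r by simp
  have E: "measure lborel E \<ge> \<alpha> * (r ^ CARD('n) * measure lborel (ball (0::real^'n) 1))"
  proof -
    have "measure lebesgue (ball z r) > 0"
      using content_ball_pos[OF r, of z] by simp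
    then have "measure lebesgue E \<ge> \<alpha> * measure lebesgue (ball z r)"
      using asym z(1) r by (auto simp: asymmetric_def E_def pos_le_divide_eq)
    then show ?thesis by (simp add: vol)
  qed
  have low: "r powr (- real CARD('n)) * exp (-1) \<le> heat (r\<^sup>2) (w - y)" if "w \<in> E" for w
  proof -
    have "dist w y \<le> dist w z + dist z y" by (rule dist_triangle)
    also have "\<dots> \<le> 2 * r" using that z(2) by (auto simp: E_def dist_commute)
    finally have "(norm (w - y))\<^sup>2 \<le> (2 * r)\<^sup>2" by (intro power_mono) (auto simp: dist_norm)
    then have "(norm (w - y))\<^sup>2 / (4 * r\<^sup>2) \<le> 1" using r by (simp add: power_mult_distrib)
    moreover have "(r\<^sup>2) powr (- real CARD('n) / 2) = r powr (- real CARD('n))"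
      using r by (simp add: powr_powr flip: powr_numeral)
    ultimately show ?thesis by (auto simp: heat_def intro!: mult_left_mono)
  qed
  have int: "integrable lborel (\<lambda>w. heat (r\<^sup>2) (w - y))" by (rule integrable_heat[OF r2])
  have intE: "integrable lborel (\<lambda>w. indicator E w * (r powr (- real CARD('n)) * exp (-1)))"
    using fin by simp
  have "heat_avg y (r\<^sup>2) \<le> (LINT w|lborel. S * (heat (r\<^sup>2) (w - y) - indicator E w * (r powr (- real CARD('n)) * exp (-1))))"
    unfolding heat_avg_def
  proof (rule integral_mono)
    show "integrable lborel (\<lambda>w. zero_ext w * heat (r\<^sup>2) (w - y))" by (rule integrable_zero_ext_heat[OF r2])
    show "integrable lborel (\<lambda>w. S * (heat (r\<^sup>2) (w - y) - indicator E w * (r powr (- real CARD('n)) * exp (-1))))"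
      using int intE by simp
    fix w
    show "zero_ext w * heat (r\<^sup>2) (w - y) \<le> S * (heat (r\<^sup>2) (w - y) - indicator E w * (r powr (- real CARD('n)) * exp (-1)))"
    proof (cases "w \<in> \<Omega>")
      case True
      then show ?thesis using S(1)[OF True] heat_pos[OF r2, of "w - y"] by (simp add: zero_ext_eq E_def)
    next
      case False
      have "indicator E w * (r powr (- real CARD('n)) * exp (-1)) \<le> heat (r\<^sup>2) (w - y)"
        using low[of w] heat_pos[OF r2, of "w - y"] by (simp split: split_indicator)
      then show ?thesis using False S(2) by (simp add: zero_ext_eq)
    qed
  qed
  also have "\<dots> = S * (heat_mass TYPE('n) - measure lborel E * (r powr (- real CARD('n)) * exp (-1)))"
    using int intE by (simp add: heat_mass_eq[OF r2])
  also have "\<dots> \<le> S * (heat_mass TYPE('n) - \<alpha> * measure lborel (ball (0::real^'n) 1) * exp (-1))"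
  proof (intro mult_left_mono diff_left_mono S(2))
    have "r ^ CARD('n) * r powr (- real CARD('n)) = 1"
      using r by (simp add: powr_minus powr_realpow)
    then have "\<alpha> * measure lborel (ball (0::real^'n) 1) * exp (-1)
        = \<alpha> * (r ^ CARD('n) * measure lborel (ball (0::real^'n) 1)) * (r powr (- real CARD('n)) * exp (-1))"
      by (simp add: mult_ac)
    also have "\<dots> \<le> measure lborel E * (r powr (- real CARD('n)) * exp (-1))"
      using E by (intro mult_right_mono) auto
    finally show "\<alpha> * measure lborel (ball (0::real^'n) 1) * exp (-1)
        \<le> measure lborel E * (r powr (- real CARD('n)) * exp (-1))" .
  qed
  finally have "exp (lam * r\<^sup>2) * heat_avg y (r\<^sup>2)
      \<le> exp (lam * r\<^sup>2) * (S * (heat_mass TYPE('n) - \<alpha> * measure lborel (ball (0::real^'n) 1) * exp (-1)))"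
    by (intro mult_left_mono) auto
  with heat_mean_value_inequality[OF y r2] show ?thesis unfolding mult.assoc by (rule order.trans)
qed

end

section \<open>Bump functions and upper bounds for the first eigenvalue\<close>

text \<open>The negative powers of t are there because differentiating exp (- 1 / t) creates them:
  up to linear combinations the family is closed under differentiation, see
  \<open>DERIV_bump\<close>.\<close>

definition bump :: "nat \<Rightarrow> real \<Rightarrow> real" where
  "bump m t = (if t > 0 then exp (- 1 / t) / t ^ m else 0)"

text \<open>One term of the exponential series at 1 / t. The exponent m + 2 leaves a factor t^2, so
  the difference quotient at 0 tends to zero and the formula of \<open>DERIV_bump\<close> holds at 0
  as well.\<close>

lemma bump_le:
  assumes "t > 0"
  shows "bump m t \<le> fact (m + 2) * t\<^sup>2"
proof -
  have "(1 / t) ^ (m + 2) / fact (m + 2) \<le> exp (1 / t)"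
  proof -
    have "(1 / t) ^ (m + 2) / fact (m + 2) = (\<Sum>k\<in>{m+2}. (1 / t) ^ k /\<^sub>R fact k)"
      by (simp add: divide_inverse mult.commute)
    also have "\<dots> \<le> (\<Sum>k. (1 / t) ^ k /\<^sub>R fact k)"
      using assms by (intro sum_le_suminf summable_exp_generic) auto
    finally show ?thesis by (simp add: exp_def)
  qed
  then have "inverse (t ^ (m + 2) * fact (m + 2)) \<le> exp (1 / t)"
    by (simp only: power_one_over inverse_eq_divide divide_divide_eq_left)
  then have "inverse (exp (1 / t)) \<le> t ^ (m + 2) * fact (m + 2)"
    using le_imp_inverse_le[of "inverse (t ^ (m + 2) * fact (m + 2))" "exp (1 / t)"] assms by simp
  then have "exp (- 1 / t) \<le> fact (m + 2) * t\<^sup>2 * t ^ m"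
    by (simp only: exp_minus[symmetric] minus_divide_left power_add mult_ac)
  then show ?thesis using assms by (simp add: bump_def pos_divide_le_eq del: fact_Suc add_2_eq_Suc')
qed

lemma DERIV_bump:
  "(bump m has_real_derivative - real m * bump (m + 1) t + bump (m + 2) t) (at t)"
proof (cases t "0 :: real" rule: linorder_cases)
  case greater
  have "((\<lambda>t. exp (- 1 / t) * inverse (t ^ m)) has_real_derivative
      - real m * bump (m + 1) t + bump (m + 2) t) (at t)"
  proof (cases m)
    case (Suc k)
    show ?thesis
      using greater unfolding Suc
      by (auto intro!: derivative_eq_intros simp: bump_def)
        (cases k; simp add: field_simps power2_eq_square)
  qed (use greater in \<open>auto intro!: derivative_eq_intros simp: bump_def field_simps power2_eq_square\<close>)
  then show ?thesis
    by (rule has_field_derivative_transform_within_open[of _ _ _ "{0<..}"])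
      (use greater in \<open>auto simp: bump_def divide_inverse\<close>)
next
  case less
  have "((\<lambda>_. 0) has_real_derivative 0) (at t)" by simp
  then have "(bump m has_real_derivative 0) (at t)"
    by (rule has_field_derivative_transform_within_open[of _ _ _ "{..<0}"])
      (use less in \<open>auto simp: bump_def\<close>)
  then show ?thesis using less by (simp add: bump_def)
next
  case equal
  have "((\<lambda>h. (bump m h - bump m 0) / h) \<longlongrightarrow> 0) (at 0)"
  proof (rule Lim_null_comparison)
    have "norm ((bump m h - bump m 0) / h) \<le> fact (m + 2) * \<bar>h\<bar>" for h
    proof (cases "h > 0")
      case True
      then have "0 \<le> bump m h" by (simp add: bump_def)
      then show ?thesis using True bump_le[OF True, of m]
        by (simp add: bump_def[of m 0] pos_divide_le_eq power2_eq_square mult.assoc)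
    next
      case False
      then have "bump m h = 0" "bump m 0 = 0" by (simp_all add: bump_def)
      then show ?thesis by (simp del: fact_Suc add_2_eq_Suc')
    qed
    then show "\<forall>\<^sub>F h in at 0. norm ((bump m h - bump m 0) / h) \<le> fact (m + 2) * \<bar>h\<bar>" by simp
    have "((\<lambda>h. fact (m + 2) * \<bar>h\<bar>) \<longlongrightarrow> fact (m + 2) * \<bar>0\<bar>) (at (0::real))"
      by (intro tendsto_intros)
    then show "((\<lambda>h::real. fact (m + 2) * \<bar>h\<bar>) \<longlongrightarrow> 0) (at 0)" by simp
  qed
  then show ?thesis using equal by (simp add: has_field_derivative_iff bump_def)
qed

lemma continuous_on_bump: "continuous_on A (bump m)"
  using DERIV_isCont[OF DERIV_bump] by (simp add: continuous_at_imp_continuous_on)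

context
  fixes a :: "real^'n" and R :: real
begin

text \<open>A class of differentiable functions that is closed under partial derivatives: its members are
  therefore smooth, without any analysis of higher derivatives of the bump.\<close>

inductive bump_algebra :: "(real^'n \<Rightarrow> real) \<Rightarrow> bool" where
  bump: "bump_algebra (\<lambda>x. bump m (1 - (norm (x - a))\<^sup>2 / R\<^sup>2))"
| component: "bump_algebra (\<lambda>x. c * (x - a) $ i)"
| const: "bump_algebra (\<lambda>x. c)"
| add: "bump_algebra f \<Longrightarrow> bump_algebra g \<Longrightarrow> bump_algebra (\<lambda>x. f x + g x)"
| mult: "bump_algebra f \<Longrightarrow> bump_algebra g \<Longrightarrow> bump_algebra (\<lambda>x. f x * g x)"

text \<open>The derivative is written as a literal combination of members of
  \<open>bump_algebra\<close>, so that the introduction rules apply to it directly.\<close>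

lemma C1_with_bump:
  "C1_with (\<lambda>x. bump m (1 - (norm (x - a))\<^sup>2 / R\<^sup>2))
    (\<lambda>i x. (- real m * bump (m + 1) (1 - (norm (x - a))\<^sup>2 / R\<^sup>2) + bump (m + 2) (1 - (norm (x - a))\<^sup>2 / R\<^sup>2))
      * (- 2 / R\<^sup>2 * (x - a) $ i))"
proof -
  have "C1_with (\<lambda>x. 1 - (norm (x - a))\<^sup>2 / R\<^sup>2) (\<lambda>i x. - 1 / R\<^sup>2 * (2 * (x - a) $ i))"
    by (rule C1_with_compose[OF C1_with_norm_diff_sq])
      (auto intro!: DERIV_cong[OF DERIV_diff[OF DERIV_const DERIV_cdivide[OF DERIV_ident]]])
  then have "C1_with (\<lambda>x. 1 - (norm (x - a))\<^sup>2 / R\<^sup>2) (\<lambda>i x. - 2 / R\<^sup>2 * (x - a) $ i)"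
    by (simp add: mult.assoc)
  then show ?thesis
    by (rule C1_with_compose[OF _ DERIV_bump]) (intro continuous_intros continuous_on_bump)
qed

lemma bump_algebra_C1_with:
  assumes "bump_algebra f"
  shows "\<exists>f'. C1_with f f' \<and> (\<forall>i. bump_algebra (f' i))"
  using assms
proof induction
  case (bump m)
  show ?case
    by (intro exI conjI allI, rule C1_with_bump)
      (intro bump_algebra.intros)
next
  case (component c i)
  have "bump_algebra (\<lambda>y. if j = i then c else 0)" for j
    by (rule bump_algebra.const)
  then show ?case using C1_with_component[of c a i] by blast
next
  case (const c)
  have "C1_with (\<lambda>_::real^'n. c) (\<lambda>_ _. 0)" by (simp add: C1_with_def)
  then show ?case using bump_algebra.const by blast
next
  case (add f g)
  then obtain f' g' where fg: "C1_with f f'" "\<And>i. bump_algebra (f' i)" "C1_with g g'" "\<And>i. bump_algebra (g' i)"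
    by blast
  have "C1_with (\<lambda>x. f x + g x) (\<lambda>i x. f' i x + g' i x)"
    unfolding C1_with_def
  proof (intro conjI allI)
    fix x
    show "((\<lambda>x. f x + g x) has_derivative (\<lambda>v. \<Sum>i\<in>UNIV. v $ i * (f' i x + g' i x))) (at x)"
      by (rule has_derivative_eq_rhs[OF has_derivative_add[OF C1_withD(1)[OF fg(1)] C1_withD(1)[OF fg(3)]]])
        (simp add: fun_eq_iff sum.distrib algebra_simps)
  qed (intro continuous_intros C1_withD(2)[OF fg(1)] C1_withD(2)[OF fg(3)])
  then show ?case using bump_algebra.add[OF fg(2,4)] by blast
next
  case (mult f g)
  then obtain f' g' where fg: "C1_with f f'" "\<And>i. bump_algebra (f' i)" "C1_with g g'" "\<And>i. bump_algebra (g' i)"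
    by blast
  show ?case
    by (intro exI conjI allI, rule C1_with_mult[OF fg(1,3)])
      (intro bump_algebra.add bump_algebra.mult fg mult)
qed

lemma smooth_on_bump_algebra:
  assumes "bump_algebra f"
  shows "smooth_on UNIV f"
  unfolding smooth_on_def
proof
  fix k
  show "C_k_on k UNIV f" using assms
  proof (induction k arbitrary: f)
    case 0
    then show ?case using bump_algebra_C1_with C1_withD(3) by fastforce
  next
    case (Suc k)
    obtain f' where f': "C1_with f f'" "\<And>i. bump_algebra (f' i)"
      using bump_algebra_C1_with[OF Suc.prems] by blast
    have "pderiv_at i f = f' i" for i
      using pderiv_at_eqI'[OF C1_withD(1)[OF f'(1)]] by auto
    moreover have "f differentiable (at x)" for x
      using C1_withD(1)[OF f'(1)] by (auto simp: differentiable_def)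
    ultimately show ?case using Suc.IH[OF f'(2)] by simp
  qed
qed

end

text \<open>The Rayleigh quotient of z -> bump 0 (1 - |z|^2), a bump on the unit ball: its gradient
  is -2 bump 2 (1 - |z|^2) z.\<close>

definition bump_rayleigh :: "'n::finite itself \<Rightarrow> real" where
  "bump_rayleigh _ = (LINT z|lborel. 4 * (bump 2 (1 - (norm (z::real^'n))\<^sup>2))\<^sup>2 * (norm z)\<^sup>2)
     / (LINT z|lborel. (bump 0 (1 - (norm (z::real^'n))\<^sup>2))\<^sup>2)"

lemma borel_measurable_bump [measurable]: "bump m \<in> borel_measurable borel"
  by (rule borel_measurable_continuous_onI[OF continuous_on_bump])

text \<open>Under x = a + R z both integrals gain R^n, and the squared gradient contributes the
  factor 1 / R^2.\<close>

lemma rayleigh_bump: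
  fixes a :: "real^'n"
  assumes R: "R > 0"
  shows "rayleigh (\<lambda>x. bump 0 (1 - (norm (x - a))\<^sup>2 / R\<^sup>2)) = bump_rayleigh TYPE('n) / R\<^sup>2"
proof -
  let ?u = "\<lambda>x. bump 0 (1 - (norm (x - a))\<^sup>2 / R\<^sup>2)"
  have s: "(norm (a + R *\<^sub>R z - a))\<^sup>2 / R\<^sup>2 = (norm z)\<^sup>2" for z :: "real^'n"
    using R by (simp add: power_mult_distrib)
  \<comment> \<open>For m = 0 the \<open>bump 1\<close> term in \<open>C1_with_bump\<close> has
    coefficient 0, so only \<open>bump 2\<close> remains.\<close>
  have "pderiv_at i ?u x = bump 2 (1 - (norm (x - a))\<^sup>2 / R\<^sup>2) * (- 2 / R\<^sup>2 * (x - a) $ i)" for i x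
    using pderiv_at_eqI'[OF C1_withD(1)[OF C1_with_bump[of 0 a R]]] by (simp add: numeral_2_eq_2)
  then have "grad ?u x = (bump 2 (1 - (norm (x - a))\<^sup>2 / R\<^sup>2) * (- 2 / R\<^sup>2)) *\<^sub>R (x - a)" for x
    by (simp add: grad_def vec_eq_iff)
  then have g: "(norm (grad ?u x))\<^sup>2
      = 4 * (bump 2 (1 - (norm (x - a))\<^sup>2 / R\<^sup>2))\<^sup>2 * (norm (x - a))\<^sup>2 / R\<^sup>2 / R\<^sup>2" for x
    by (simp add: power_mult_distrib power_divide)
  have "(LINT x|lebesgue. (norm (grad ?u x))\<^sup>2)
      = (LINT x|lborel. 4 * (bump 2 (1 - (norm (x - a))\<^sup>2 / R\<^sup>2))\<^sup>2 * (norm (x - a))\<^sup>2 / R\<^sup>2 / R\<^sup>2)"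
    unfolding g by (rule integral_completion) measurable
  also have "\<dots> = R ^ CARD('n) * (LINT z|lborel. 4 * (bump 2 (1 - (norm z)\<^sup>2))\<^sup>2 * (norm (z::real^'n))\<^sup>2 / R\<^sup>2)"
  proof -
    have p: "4 * (bump 2 (1 - (norm (a + R *\<^sub>R z - a))\<^sup>2 / R\<^sup>2))\<^sup>2 * (norm (a + R *\<^sub>R z - a))\<^sup>2 / R\<^sup>2 / R\<^sup>2
        = 4 * (bump 2 (1 - (norm z)\<^sup>2))\<^sup>2 * (norm z)\<^sup>2 / R\<^sup>2" for z
      unfolding times_divide_eq_right[symmetric] s ..
    show ?thesis
      by (subst lborel_integral_affine[OF _ R, of _ a]) (measurable, simp only: p DIM_cart DIM_real mult_1_right)
  qed
  finally have num: "(LINT x|lebesgue. (norm (grad ?u x))\<^sup>2)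
      = R ^ CARD('n) * (LINT z|lborel. 4 * (bump 2 (1 - (norm z)\<^sup>2))\<^sup>2 * (norm (z::real^'n))\<^sup>2) / R\<^sup>2"
    by simp
  have "(LINT x|lebesgue. (?u x)\<^sup>2) = (LINT x|lborel. (?u x)\<^sup>2)"
    by (rule integral_completion) measurable
  also have "\<dots> = R ^ CARD('n) * (LINT z|lborel. (bump 0 (1 - (norm (z::real^'n))\<^sup>2))\<^sup>2)"
    by (subst lborel_integral_affine[OF _ R, of _ a]) (measurable, simp only: s DIM_cart DIM_real mult_1_right)
  finally show ?thesis
    unfolding rayleigh_def num bump_rayleigh_def using R by simp
qed

text \<open>The bump scaled to this ball is an admissible competitor. The ball is closed because the
  closure of the support must lie in the interior of U.\<close>

lemma lambda1_le_if_contains_cball: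
  fixes a :: "real^'n"
  assumes R: "R > 0" and sub: "cball a R \<subseteq> interior U"
  shows "lambda1 U \<le> ereal (bump_rayleigh TYPE('n) / R\<^sup>2)"
proof -
  let ?u = "\<lambda>x. bump 0 (1 - (norm (x - a))\<^sup>2 / R\<^sup>2)"
  have "x \<in> cball a R" if "?u x \<noteq> 0" for x
  proof -
    have "(norm (x - a))\<^sup>2 < R\<^sup>2" using that R by (auto simp: bump_def split: if_splits)
    then show ?thesis using R power2_less_imp_less[of "norm (x - a)" R]
      by (simp add: dist_norm norm_minus_commute)
  qed
  then have cl: "closure {x. ?u x \<noteq> 0} \<subseteq> cball a R"
    by (intro closure_minimal) auto
  have "test_fun (interior U) ?u"
    unfolding test_fun_def
  proof (intro conjI)
    show "smooth_on UNIV ?u" by (rule smooth_on_bump_algebra[OF bump_algebra.bump])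
    show "compact (closure {x. ?u x \<noteq> 0})"
      using bounded_subset[OF bounded_cball cl] by (simp add: compact_eq_bounded_closed)
    show "closure {x. ?u x \<noteq> 0} \<subseteq> interior U" using cl sub by blast
  qed
  moreover have "?u a \<noteq> 0" by (simp add: bump_def)
  ultimately have "lambda1 U \<le> ereal (rayleigh ?u)"
    unfolding lambda1_def by (intro INF_lower CollectI conjI exI[of _ a])
  then show ?thesis by (simp add: rayleigh_bump[OF R])
qed

lemma lambda1_nonneg: "lambda1 U \<ge> 0"
  unfolding lambda1_def rayleigh_def by (intro INF_greatest) simp

lemma lambda1_antimono:
  assumes "U \<subseteq> V"
  shows "lambda1 V \<le> lambda1 U"
proof -
  have "interior U \<subseteq> interior V" using assms by (rule interior_mono)
  then show ?thesis
    unfolding lambda1_def by (intro INF_superset_mono order_refl) (auto simp: test_fun_def)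
qed

text \<open>A hyperplane separates y strictly from the closure of D. Moving the centre from y by r /
  2 along its normal, away from D, puts the ball of radius r / 2 into the half-space bounded by the
  parallel hyperplane through y.\<close>

lemma convex_complement_contains_ball:
  fixes y :: "'a::euclidean_space"
  assumes "convex D" "D \<noteq> {}" "y \<notin> closure D" "r > 0"
  obtains c where "ball c (r / 2) \<subseteq> ball y r - D"
proof -
  obtain a b where ab: "a \<bullet> y < b" "\<And>x. x \<in> closure D \<Longrightarrow> a \<bullet> x > b"
    using separating_hyperplane_closed_point[of "closure D" y] assms convex_closure by blast
  obtain x where "x \<in> closure D" using assms(2) closure_subset by blast
  then have a: "a \<noteq> 0" using ab by force
  define c where "c = y - (r / (2 * norm a)) *\<^sub>R a"
  have yc: "y - c = (r / (2 * norm a)) *\<^sub>R a" by (simp add: c_def)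
  then have d: "dist y c = r / 2" using a assms(4) by (simp add: dist_norm)
  show thesis
  proof (rule that, rule subsetI)
    fix w assume w: "w \<in> ball c (r / 2)"
    have "dist y w < r" using w d dist_triangle[of y w c] by simp
    moreover have "w \<notin> D"
    proof
      assume "w \<in> D"
      then have "a \<bullet> w > b" using ab(2) closure_subset by blast
      have "a \<bullet> w = a \<bullet> y - a \<bullet> (y - c) + a \<bullet> (w - c)" by (simp add: inner_diff_right)
      also have "a \<bullet> (y - c) = norm a * (r / 2)"
        using a by (simp add: yc dot_square_norm power2_eq_square)
      also have "a \<bullet> (w - c) \<le> norm a * norm (w - c)" by (rule norm_cauchy_schwarz)
      also have "norm a * norm (w - c) \<le> norm a * (r / 2)"
        using w by (intro mult_left_mono) (auto simp: dist_norm norm_minus_commute)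
      finally show False using ab(1) \<open>a \<bullet> w > b\<close> by simp
    qed
    ultimately show "w \<in> ball y r - D" by simp
  qed
qed

section \<open>Maximum points of the ground state\<close>

text \<open>If the essential supremum were below the maximum, the set where \<phi> exceeds it would
  be open, nonempty and null, which is impossible.\<close>

lemma Linf_norm_eq_maximum:
  fixes \<phi> :: "real^'n \<Rightarrow> real"
  assumes \<Omega>: "open \<Omega>" and \<phi>: "continuous_on \<Omega> \<phi>" "\<And>x. x \<in> \<Omega> \<Longrightarrow> \<phi> x \<ge> 0"
    and y: "y \<in> \<Omega>" "\<And>x. x \<in> \<Omega> \<Longrightarrow> \<phi> x \<le> \<phi> y"
  shows "Linf_norm \<Omega> \<phi> = ereal (\<phi> y)"
proof -
  let ?f = "\<lambda>x. ereal \<bar>\<phi> x\<bar>"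
  let ?M = "lebesgue_on \<Omega>"
  have \<Omega>s: "\<Omega> \<in> sets lebesgue" using \<Omega> by simp
  have fc: "continuous_on \<Omega> ?f" by (intro continuous_intros \<phi>(1))
  have "\<phi> \<in> borel_measurable ?M" by (rule continuous_imp_measurable_on_sets_lebesgue[OF \<phi>(1) \<Omega>s])
  then have fm: "?f \<in> borel_measurable ?M" by measurable
  have "esssup ?M ?f \<le> ereal (\<phi> y)"
    by (rule esssup_I[OF fm], rule AE_I2) (use \<phi>(2) y(2) in \<open>auto simp: space_restrict_space\<close>)
  moreover have "\<not> esssup ?M ?f < ereal (\<phi> y)"
  proof
    assume less: "esssup ?M ?f < ereal (\<phi> y)"
    define A where "A = \<Omega> \<inter> ?f -` {esssup ?M ?f<..}"
    have "open A" unfolding A_def by (rule continuous_open_preimage[OF fc \<Omega>]) simp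
    have "y \<in> A" using y(1) \<phi>(2)[OF y(1)] less by (simp add: A_def)
    have "{x \<in> space ?M. esssup ?M ?f < ?f x} = A"
      by (auto simp: A_def space_restrict_space)
    then have "emeasure ?M A = 0" using esssup_zero_measure[of ?M ?f] by simp
    then have "emeasure lebesgue A = 0"
      using \<Omega>s by (subst (asm) emeasure_restrict_space) (auto simp: A_def)
    moreover have "A \<in> sets lebesgue" using \<open>open A\<close> by simp
    ultimately have "negligible A" by (simp add: negligible_iff_null_sets null_sets_def)
    then show False using open_not_negligible[OF \<open>open A\<close>] \<open>y \<in> A\<close> by blast
  qed
  ultimately show ?thesis unfolding Linf_norm_def by simp
qed

context positive_eigenfunction
begin

text \<open>The hypothesis \<open>small\<close> says \<theta> < 1, multiplied by the mass. Closer
  than r to the boundary \<phi> is at most \<theta> S < S, so values above \<theta> S occur only on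
  the compact set K of deeper points, where \<phi> attains its supremum.\<close>

lemma max_points_in_depth:
  assumes ne: "\<Omega> \<noteq> {}" and asym: "asymmetric \<alpha> \<Omega>"
    and small: "exp (lam * r\<^sup>2) * (heat_mass TYPE('n) - \<alpha> * measure lborel (ball (0::real^'n) 1) * exp (-1))
        < heat_mass TYPE('n)"
    and r: "r > 0"
  shows "max_points \<Omega> \<phi> \<noteq> {}" "y \<in> max_points \<Omega> \<phi> \<Longrightarrow> ball y r \<subseteq> \<Omega>"
proof -
  define S where "S = (SUP x\<in>\<Omega>. \<phi> x)"
  have bdd: "bdd_above (\<phi> ` \<Omega>)" using bounded_above by (auto simp: bdd_above_def)
  have S: "\<phi> x \<le> S" if "x \<in> \<Omega>" for x
    unfolding S_def using bdd that by (rule cSUP_upper2) simp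
  have Spos: "S > 0" using ne pos S by (metis all_not_in_conv less_le_trans)
  define G where "G = heat_mass TYPE('n)"
  have G: "G > 0" by (simp add: G_def heat_mass_pos)
  define \<theta> where "\<theta> = exp (lam * r\<^sup>2) * (G - \<alpha> * measure lborel (ball (0::real^'n) 1) * exp (-1)) / G"
  have \<theta>: "\<theta> < 1" using small G by (simp add: \<theta>_def G_def)
  have near: "\<phi> x \<le> \<theta> * S" if "x \<in> \<Omega>" "z \<in> frontier \<Omega>" "dist x z < r" for x z
  proof -
    have "G * \<phi> x \<le> exp (lam * r\<^sup>2) * S * (G - \<alpha> * measure lborel (ball (0::real^'n) 1) * exp (-1))"
      unfolding G_def by (rule near_boundary_decay[OF asym S less_imp_le[OF Spos] that])
    also have "\<dots> = G * (\<theta> * S)" using G by (simp add: \<theta>_def)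
    finally show ?thesis using G by simp
  qed
  have "\<theta> * S < S" using \<theta> Spos by simp
  then obtain x1 where x1: "x1 \<in> \<Omega>" "\<theta> * S < \<phi> x1"
    using less_cSUP_iff[OF ne bdd] unfolding S_def by auto
  \<comment> \<open>This form is visibly closed. It lies in \<Omega> because a frontier point has
    distance 0 < r from itself.\<close>
  define K where "K = closure \<Omega> \<inter> (\<Inter>z\<in>frontier \<Omega>. {x. r \<le> dist x z})"
  have K: "K = {x \<in> \<Omega>. \<forall>z\<in>frontier \<Omega>. r \<le> dist x z}"
  proof -
    have "x \<in> \<Omega>" if "x \<in> K" for x
    proof (rule ccontr)
      assume "x \<notin> \<Omega>"
      then have "x \<in> frontier \<Omega>" using that open_dom by (auto simp: K_def frontier_def interior_open)
      then have "r \<le> dist x x" using that unfolding K_def by blast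
      then show False using r by simp
    qed
    then show ?thesis using closure_subset by (auto simp: K_def)
  qed
  have "closed {x. r \<le> dist x z}" for z :: "real^'n"
    by (intro closed_Collect_le continuous_intros)
  then have "closed K" unfolding K_def by (intro closed_Int closed_INT) auto
  moreover have "bounded K" using bounded_dom by (rule bounded_subset) (auto simp: K)
  ultimately have "compact K" by (simp add: compact_eq_bounded_closed)
  moreover have x1K: "x1 \<in> K" using x1 near[OF x1(1)] by (force simp: K)
  moreover have "continuous_on K \<phi>"
    by (rule continuous_on_subset[OF smooth_onD(1)[OF smooth]]) (auto simp: K)
  ultimately obtain y0 where y0: "y0 \<in> K" "\<And>x. x \<in> K \<Longrightarrow> \<phi> x \<le> \<phi> y0"
    using continuous_attains_sup[of K \<phi>] by auto
  have y0\<Omega>: "y0 \<in> \<Omega>" using y0 by (simp add: K)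
  have max: "\<phi> x \<le> \<phi> y0" if "x \<in> \<Omega>" for x
  proof (cases "x \<in> K")
    case False
    then obtain z where "z \<in> frontier \<Omega>" "dist x z < r" using \<open>x \<in> \<Omega>\<close> by (auto simp: K not_le)
    from near[OF that this] have "\<phi> x \<le> \<theta> * S" .
    also have "\<dots> \<le> \<phi> x1" using x1 by simp
    also have "\<dots> \<le> \<phi> y0" using y0(2)[OF x1K] .
    finally show ?thesis .
  qed (rule y0(2))
  have L: "Linf_norm \<Omega> \<phi> = ereal (\<phi> y0)"
    by (rule Linf_norm_eq_maximum[OF open_dom smooth_onD(1)[OF smooth] less_imp_le[OF pos] y0\<Omega> max])
  then show "max_points \<Omega> \<phi> \<noteq> {}" using y0\<Omega> by (auto simp: max_points_def)
  assume "y \<in> max_points \<Omega> \<phi>"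
  then have y: "y \<in> \<Omega>" "\<phi> y = \<phi> y0" using L by (auto simp: max_points_def)
  have far: "r \<le> dist y z" if "z \<in> frontier \<Omega>" for z
    using near[OF y(1) that] y(2) x1(2) max[OF x1(1)] by linarith
  show "ball y r \<subseteq> \<Omega>"
  proof (rule ccontr)
    assume "\<not> ball y r \<subseteq> \<Omega>"
    \<comment> \<open>A ball is connected: meeting both \<Omega> and its complement, it would meet
      the frontier.\<close>
    then have "ball y r \<inter> frontier \<Omega> \<noteq> {}"
      using connected_Int_frontier[OF connected_ball, of y r \<Omega>] y(1) centre_in_ball[of y r] r by blast
    then show False using far by fastforce
  qed
qed

end

text \<open>\<open>lambda1\<close> is finite because the eigenvalue equation at one point of
  \<Omega> equates its product with a positive number to a real number.\<close>

lemma ground_state_eigenvalue: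
  assumes "domain \<Omega>" "bounded \<Omega>" "ground_state \<Omega> \<phi>"
  obtains lam where "lambda1 \<Omega> = ereal lam" "lam > 0" "positive_eigenfunction \<Omega> \<phi> lam"
proof -
  have \<Omega>: "open \<Omega>" "\<Omega> \<noteq> {}" using assms(1) by (auto simp: domain_def)
  then obtain x where x: "x \<in> \<Omega>" by auto
  have eq: "ereal (- laplacian \<phi> x) = lambda1 \<Omega> * ereal (\<phi> x)" and p: "\<phi> x > 0" if "x \<in> \<Omega>" for x
    using assms(3) that by (auto simp: ground_state_def)
  obtain lam where lam: "lambda1 \<Omega> = ereal lam"
    using eq[OF x] p[OF x] lambda1_nonneg[of \<Omega>] by (cases "lambda1 \<Omega>") auto
  have pe: "positive_eigenfunction \<Omega> \<phi> lam"
  proof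
    show "- laplacian \<phi> x = lam * \<phi> x" if "x \<in> \<Omega>" for x
      using eq[OF that] by (simp add: lam)
  qed (use assms \<Omega> in \<open>auto simp: ground_state_def\<close>)
  have "lam \<ge> 0" using lambda1_nonneg[of \<Omega>] lam by simp
  moreover have "lam \<noteq> 0" using positive_eigenfunction.eigenvalue_nonzero[OF pe \<Omega>(2)] .
  ultimately show thesis using that lam pe by simp
qed

theorem theorem4p1:
  fixes \<alpha> :: real
  assumes "\<alpha> > 0"
  shows "\<exists>C0::real. \<forall>(\<Omega>::(real^'n) set) (D::(real^'n) set) (xb::real^'n) (\<phi>::real^'n \<Rightarrow> real).
     domain \<Omega> \<longrightarrow> bounded \<Omega> \<longrightarrow> asymmetric \<alpha> \<Omega> \<longrightarrow>
     domain D \<longrightarrow> bounded D \<longrightarrow> convex D \<longrightarrow>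
     maximizing_translate \<Omega> D xb \<longrightarrow>
     ground_state \<Omega> \<phi> \<longrightarrow>
       (\<forall>C\<ge>C0. lambda1 (\<Omega> - translate xb D) \<ge> ereal C * lambda1 \<Omega> \<longrightarrow> rho \<Omega> \<phi> D xb = 0) \<and>
       (lambda1 \<Omega> \<le> mu \<Omega> D \<and> mu \<Omega> D < ereal C0 * lambda1 \<Omega> \<or> rho \<Omega> \<phi> D xb = 0)"
proof -
  define G where "G = heat_mass TYPE('n)"
  \<comment> \<open>c is the fraction of the heat mass that \<open>near_boundary_decay\<close>
    removes, and \<kappa> will be the value of lam r^2; then the factor of the decay estimate is (1
    + c)(1 - c) = 1 - c^2.\<close>
  define c where "c = \<alpha> * measure lborel (ball (0::real^'n) 1) * exp (-1) / G"
  define \<kappa> where "\<kappa> = ln (1 + c)"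
  define K where "K = bump_rayleigh TYPE('n)"
  \<comment> \<open>With a closed ball of radius r / 4 beside the obstacle, \<open>lambda1\<close>
    of the complement is at most 16 K / r^2 = 16 K / \<kappa> times lam. The + 1 makes C >= C0
    contradict this strictly.\<close>
  define C0 where "C0 = 16 * \<bar>K\<bar> / \<kappa> + 1"
  have G: "G > 0" by (simp add: G_def heat_mass_pos)
  have c: "c > 0"
    unfolding c_def using assms G content_ball_pos[of 1 "0::real^'n"] by (intro divide_pos_pos mult_pos_pos) auto
  have \<kappa>: "\<kappa> > 0" using c by (simp add: \<kappa>_def)
  have rho0: "rho \<Omega> \<phi> D xb = 0"
    if dom: "domain \<Omega>" "bounded \<Omega>" "asymmetric \<alpha> \<Omega>" "domain D" "convex D" "ground_state \<Omega> \<phi>"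
      and C: "C \<ge> C0" "lambda1 (\<Omega> - translate xb D) \<ge> ereal C * lambda1 \<Omega>"
    for \<Omega> D :: "(real^'n) set" and xb :: "real^'n" and \<phi> :: "real^'n \<Rightarrow> real" and C :: real
  proof -
    obtain lam where lam: "lambda1 \<Omega> = ereal lam" "lam > 0" and pe: "positive_eigenfunction \<Omega> \<phi> lam"
      using ground_state_eigenvalue[OF dom(1,2,6)] by blast
    interpret positive_eigenfunction \<Omega> \<phi> lam by (rule pe)
    have ne: "\<Omega> \<noteq> {}" using dom(1) by (simp add: domain_def)
    define r where "r = sqrt (\<kappa> / lam)"
    have r: "r > 0" "lam * r\<^sup>2 = \<kappa>" using \<kappa> lam(2) by (auto simp: r_def)
    have "exp (lam * r\<^sup>2) * (G - \<alpha> * measure lborel (ball (0::real^'n) 1) * exp (-1)) = (1 + c) * (G * (1 - c))"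
      using c G by (simp add: r(2) \<kappa>_def c_def right_diff_distrib)
    also have "\<dots> = G - G * c\<^sup>2" by (simp add: power2_eq_square algebra_simps)
    also have "\<dots> < G" using G c by simp
    finally have small: "exp (lam * r\<^sup>2) * (heat_mass TYPE('n) - \<alpha> * measure lborel (ball (0::real^'n) 1) * exp (-1))
        < heat_mass TYPE('n)" by (simp add: G_def)
    define T where "T = translate xb D"
    have T: "convex T" "T \<noteq> {}"
      using dom(4,5) by (auto simp: T_def translate_def domain_def)
    have "infdist y T = 0" if y: "y \<in> max_points \<Omega> \<phi>" for y
    proof (rule ccontr)
      assume "infdist y T \<noteq> 0"
      then have "y \<notin> closure T" using in_closure_iff_infdist_zero[OF T(2)] by simp
      then obtain x where "ball x (r / 2) \<subseteq> ball y r - T"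
        using convex_complement_contains_ball[OF T _ r(1)] by blast
      also have "\<dots> \<subseteq> \<Omega> - T" using max_points_in_depth(2)[OF ne dom(3) small r(1) y] by blast
      finally have "ball x (r / 2) \<subseteq> interior (\<Omega> - T)" by (simp add: interior_maximal)
      moreover have "cball x (r / 4) \<subseteq> ball x (r / 2)" using r(1) by (auto simp: subset_eq)
      ultimately have "lambda1 (\<Omega> - T) \<le> ereal (K / (r / 4)\<^sup>2)"
        unfolding K_def using r(1) by (intro lambda1_le_if_contains_cball) auto
      with C(2) have "ereal C * ereal lam \<le> ereal (K / (r / 4)\<^sup>2)"
        unfolding T_def lam(1) by (rule order.trans)
      then have "C * lam \<le> 16 * K / r\<^sup>2" by (simp add: power_divide mult.commute)
      also have "\<dots> = 16 * K / \<kappa> * lam" using lam(2) r by (simp add: r(2)[symmetric])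
      finally have "C \<le> 16 * K / \<kappa>" using lam(2) by (rule mult_right_le_imp_le)
      also have "\<dots> \<le> 16 * \<bar>K\<bar> / \<kappa>" using \<kappa> by (intro divide_right_mono) auto
      finally show False using C(1) by (simp add: C0_def)
    qed
    \<comment> \<open>Nonemptiness of the set of maximum points matters: the real supremum over the
      empty set has no useful value.\<close>
    then have "(\<lambda>y. infdist y T) ` max_points \<Omega> \<phi> = {0}"
      using max_points_in_depth(1)[OF ne dom(3) small r(1)] by auto
    then show ?thesis by (simp add: rho_def T_def)
  qed
  show ?thesis
  proof (intro exI[of _ C0] allI impI conjI)
    fix \<Omega> D :: "(real^'n) set" and xb :: "real^'n" and \<phi> :: "real^'n \<Rightarrow> real"
    assume a: "domain \<Omega>" "bounded \<Omega>" "asymmetric \<alpha> \<Omega>" "domain D" "bounded D" "convex D"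
      "maximizing_translate \<Omega> D xb" "ground_state \<Omega> \<phi>"
    show "rho \<Omega> \<phi> D xb = 0" if "C0 \<le> C" "ereal C * lambda1 \<Omega> \<le> lambda1 (\<Omega> - translate xb D)" for C
      by (rule rho0[OF a(1-4,6,8) that])
    \<comment> \<open>Maximality of xb turns the supremum into the value at xb, so the failure of mu
      < C0 lambda is the hypothesis of \<open>rho0\<close> with C = C0.\<close>
    have mu: "mu \<Omega> D = lambda1 (\<Omega> - translate xb D)"
      unfolding mu_def using a(7) by (intro antisym SUP_least SUP_upper) (auto simp: maximizing_translate_def)
    have "lambda1 \<Omega> \<le> mu \<Omega> D" unfolding mu by (rule lambda1_antimono) auto
    moreover have "rho \<Omega> \<phi> D xb = 0" if "\<not> mu \<Omega> D < ereal C0 * lambda1 \<Omega>"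
      using that rho0[OF a(1-4,6,8) order_refl] by (simp add: mu)
    ultimately show "lambda1 \<Omega> \<le> mu \<Omega> D \<and> mu \<Omega> D < ereal C0 * lambda1 \<Omega> \<or> rho \<Omega> \<phi> D xb = 0"
      by blast
  qed
qed

end
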